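(* Let $G=(V,E)$ be a finite connected simple graph and let $f:V\to\mathbf{R}$ be an injective filter function. Then the Faster Algorithm, applied to $(G,f)$, outputs the same extended persistence diagram as the Matrix Reduction Algorithm, applied to $(G,f)$. That is, the multiset union of the 0-dim PD and the 1-dim PD output by the Faster Algorithm equals the multiset $PD$ output by the Matrix Reduction Algorithm.
   Context: **Simplices and orders.** The simplices of $G$ are its nodes and edges; $m=|V|+|E|$. For an edge $uv$ put $f_a(uv)=\max(f(u),f(v))$ (ascending filter value) and $f_d(uv)=\min(f(u),f(v))$ (descending filter value); for a node $f_a=f_d=f$. The ascending sequence $\kappa_1,\dots,\kappa_m$ lists all simplices by nondecreasing $f_a$, each edge coming after both its endpoints; the descending sequence $\lambda_1,\dots,\lambda_m$ lists all simplices by nonincreasing $f_d$, each edge coming after both its endpoints. Remaining ties between edges are broken arbitrarily; both sequences are then fixed and used by both algorithms. **Matrix Reduction Algorithm.** Let $M=\begin{bmatrix}A&P\\0&D\end{bmatrix}$ be the $2m\times 2m$ matrix over $\mathbb{F}_2$ with $m\times m$ blocks: $A[i,j]=1$ iff $\kappa_i$ is a node that is an endpoint of the edge $\kappa_j$; $D[i,j]=1$ iff $\lambda_i$ is a node that is an endpoint of the edge $\lambda_j$; $P[i,j]=1$ iff $\kappa_i$ and $\lambda_j$ are the same simplex. Index $i\le m$ (row or column) represents $\kappa_i$ with value $f_a(\kappa_i)$; index $m+i$ represents $\lambda_i$ with value $f_d(\lambda_i)$. For a nonzero column $j$, $low_M(j)$ is the largest row index with entry 1 in column $j$. For $j=1,\dots,2m$: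 while there is $k<j$ with column $k$ nonzero, column $j$ nonzero and $low_M(k)=low_M(j)$, add (mod 2) column $k$ to column $j$; afterwards, if column $j$ is nonzero, add the point (value of index $low_M(j)$, value of index $j$) to the multiset $PD$. Output $PD$. **Faster Algorithm.** (0-dim PD, by Union-Find.) Insert the simplices in the ascending order; whenever an edge $e$ joins two different connected components, let $v$ be the later-born of the two nodes that are the earliest nodes of these components, and record the point $(f(v),f_a(e))$. Do the same in the descending order, recording $(f(v),f_d(e))$. Additionally record $(\min_V f,\max_V f)$ for the whole connected component. The multiset of these points is the 0-dim PD. (Edge types.) In the descending pass, an edge is negative if at its insertion it joins two different components, and positive otherwise; $E_{neg},E_{pos}$ are the sets of these edges. (1-dim PD.) Initialize $\mathcal{T}$ as the spanning tree with node set $V$ and edge set $E_{neg}$; fix a root $r$. For each $e_j=uv\in E_{pos}$, in descending-sequence order: let $Path_u,Path_v$ be the edge sets of the paths in $\mathcal{T}$ from $u$ and from $v$ to $r$; set $Loop=((Path_u\cup Path_v)\setminus(Path_u\cap Path_v))\cup\{e_j\}$; let $e_k$ be the edge of $Loop$ that comes latest in the ascending sequence (so it maximizes $f_a$ on $Loop$); add the point $(f_a(e_k),f_d(e_j))$ to the 1-dim PD; replace $\mathcal{T}$ by $\mathcal{T}-\{e_k\}+\{e_j\}$. Output the 0-dim PD and 1-dim PD (multisets). *)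

theory Defs
  imports
    Complex_Main
    "HOL-Library.Multiset"
    "HOL-Library.Z2"
    "Jordan_Normal_Form.Column_Operations"
begin

section \<open>Finite connected simple graphs\<close>

text \<open>A path is given by its list of nodes; it runs inside an edge set.\<close>

fun path_edges :: "'a list \<Rightarrow> 'a set set" where
  "path_edges (u # v # p) = insert {u, v} (path_edges (v # p))"
| "path_edges _ = {}"

definition is_path :: "'a set set \<Rightarrow> 'a \<Rightarrow> 'a list \<Rightarrow> 'a \<Rightarrow> bool" where
  "is_path T u p v \<longleftrightarrow>
     p \<noteq> [] \<and> hd p = u \<and> last p = v \<and> distinct p \<and> path_edges p \<subseteq> T"

definition simple_graph :: "'a set \<Rightarrow> 'a set set \<Rightarrow> bool" where
  "simple_graph V E \<longleftrightarrow> finite V \<and> V \<noteq> {} \<and> (\<forall>e\<in>E. e \<subseteq> V \<and> card e = 2)"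

definition connected_graph :: "'a set \<Rightarrow> 'a set set \<Rightarrow> bool" where
  "connected_graph V E \<longleftrightarrow> (\<forall>u\<in>V. \<forall>v\<in>V. \<exists>p. is_path E u p v)"


section \<open>Simplices and orders\<close>

datatype 'a simplex = Node 'a | Edge "'a set"

definition simplices :: "'a set \<Rightarrow> 'a set set \<Rightarrow> 'a simplex set" where
  "simplices V E = Node ` V \<union> Edge ` E"

fun incident :: "'a simplex \<Rightarrow> 'a simplex \<Rightarrow> bool" where
  "incident (Node v) (Edge e) = (v \<in> e)"
| "incident _ _ = False"

fun asc_value :: "('a \<Rightarrow> real) \<Rightarrow> 'a simplex \<Rightarrow> real" where
  "asc_value f (Node v) = f v"
| "asc_value f (Edge e) = Max (f ` e)"

fun desc_value :: "('a \<Rightarrow> real) \<Rightarrow> 'a simplex \<Rightarrow> real" where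
  "desc_value f (Node v) = f v"
| "desc_value f (Edge e) = Min (f ` e)"

definition simplex_order :: "'a set \<Rightarrow> 'a set set \<Rightarrow> 'a simplex list \<Rightarrow> bool" where
  "simplex_order V E s \<longleftrightarrow>
     distinct s \<and> set s = simplices V E \<and>
     (\<forall>i<length s. \<forall>j<length s. incident (s ! i) (s ! j) \<longrightarrow> i < j)"

definition ascending_sequence ::
  "'a set \<Rightarrow> 'a set set \<Rightarrow> ('a \<Rightarrow> real) \<Rightarrow> 'a simplex list \<Rightarrow> bool" where
  "ascending_sequence V E f \<kappa> \<longleftrightarrow>
     simplex_order V E \<kappa> \<and> sorted_wrt (\<le>) (map (asc_value f) \<kappa>)"

definition descending_sequence ::
  "'a set \<Rightarrow> 'a set set \<Rightarrow> ('a \<Rightarrow> real) \<Rightarrow> 'a simplex list \<Rightarrow> bool" where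
  "descending_sequence V E f \<Lambda> \<longleftrightarrow>
     simplex_order V E \<Lambda> \<and> sorted_wrt (\<ge>) (map (desc_value f) \<Lambda>)"

definition position :: "'a simplex list \<Rightarrow> 'a simplex \<Rightarrow> nat" where
  "position s x = (LEAST i. i < length s \<and> s ! i = x)"


section \<open>Matrix Reduction Algorithm\<close>

text \<open>
  All indices start from 0: with \<open>m = length \<kappa>\<close>, index \<open>i < m\<close> stands for \<open>\<kappa> ! i\<close>
  and index \<open>m + i\<close> for \<open>\<Lambda> ! i\<close>. The type \<^typ>\<open>bit\<close> is the field with two elements.
\<close>

definition boundary_matrix :: "'a simplex list \<Rightarrow> bit mat" where
  "boundary_matrix s =
     mat (length s) (length s) (\<lambda>(i, j). of_bool (incident (s ! i) (s ! j)))"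

definition permutation_matrix :: "'a simplex list \<Rightarrow> 'a simplex list \<Rightarrow> bit mat" where
  "permutation_matrix \<kappa> \<Lambda> =
     mat (length \<kappa>) (length \<Lambda>) (\<lambda>(i, j). of_bool (\<kappa> ! i = \<Lambda> ! j))"

definition extended_matrix :: "'a simplex list \<Rightarrow> 'a simplex list \<Rightarrow> bit mat" where
  "extended_matrix \<kappa> \<Lambda> =
     four_block_mat (boundary_matrix \<kappa>) (permutation_matrix \<kappa> \<Lambda>)
                    (0\<^sub>m (length \<Lambda>) (length \<kappa>)) (boundary_matrix \<Lambda>)"

definition index_value ::
  "('a \<Rightarrow> real) \<Rightarrow> 'a simplex list \<Rightarrow> 'a simplex list \<Rightarrow> nat \<Rightarrow> real" where
  "index_value f \<kappa> \<Lambda> i =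
     (if i < length \<kappa> then asc_value f (\<kappa> ! i)
      else desc_value f (\<Lambda> ! (i - length \<kappa>)))"

definition nonzero_col :: "bit mat \<Rightarrow> nat \<Rightarrow> bool" where
  "nonzero_col M j \<longleftrightarrow> (\<exists>i<dim_row M. M $$ (i, j) = 1)"

definition low :: "bit mat \<Rightarrow> nat \<Rightarrow> nat" where
  "low M j = Max {i. i < dim_row M \<and> M $$ (i, j) = 1}"

definition reducible_by :: "bit mat \<Rightarrow> nat \<Rightarrow> nat \<Rightarrow> bool" where
  "reducible_by M j k \<longleftrightarrow>
     k < j \<and> nonzero_col M k \<and> nonzero_col M j \<and> low M k = low M j"

text \<open>
  One iteration of the inner loop on column \<open>j\<close>. The choice of \<open>k\<close> is left open, so
  the loop is a relation; \<open>addcol 1 j k M\<close> adds column \<open>k\<close> of \<open>M\<close> to column \<open>j\<close>.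
\<close>

definition reduction_step :: "nat \<Rightarrow> bit mat \<Rightarrow> bit mat \<Rightarrow> bool" where
  "reduction_step j M M' \<longleftrightarrow> (\<exists>k. reducible_by M j k \<and> M' = addcol 1 j k M)"

definition reduce_column :: "nat \<Rightarrow> bit mat \<Rightarrow> bit mat \<Rightarrow> bool" where
  "reduce_column j M M' \<longleftrightarrow>
     (reduction_step j)\<^sup>*\<^sup>* M M' \<and> (\<nexists>k. reducible_by M' j k)"

text \<open>The inner loop cannot run forever: the lowest entry of column \<open>j\<close> strictly drops.\<close>

lemma reduction_step_decreases:
  assumes "reduction_step j M M'" and "j < dim_col M"
  shows "dim_col M' = dim_col M" and "nonzero_col M' j \<Longrightarrow> low M' j < low M j"
proof -
  obtain k where k: "reducible_by M j k" and M': "M' = addcol 1 j k M"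
    using assms(1) by (auto simp: reduction_step_def)
  show "dim_col M' = dim_col M"
    by (simp add: M')
  let ?S = "\<lambda>M j. {i. i < dim_row M \<and> M $$ (i, j) = (1::bit)}"
  have fin: "finite (?S N c)" for N c by simp
  have ne: "?S M j \<noteq> {}" "?S M k \<noteq> {}" and eq: "low M k = low M j" and kj: "k < j"
    using k by (auto simp: reducible_by_def nonzero_col_def)
  have top: "low M j \<in> ?S M j" "low M j \<in> ?S M k"
    using Max_in[OF fin ne(1)] Max_in[OF fin ne(2)] eq by (auto simp: low_def)
  have entry: "M' $$ (i, j) = M $$ (i, k) + M $$ (i, j)" if "i < dim_row M" for i
    using that assms(2) by (simp add: M')
  have "i < low M j" if i: "i \<in> ?S M' j" for i
  proof -
    have lt: "i < dim_row M" and one: "M $$ (i, k) + M $$ (i, j) = 1"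
      using i entry by (auto simp: M')
    have "i \<noteq> low M j" using top one by auto
    moreover have "i \<in> ?S M k \<or> i \<in> ?S M j"
      using one lt by (cases "M $$ (i, k)"; cases "M $$ (i, j)") auto
    then have "i \<le> low M j"
      using Max_ge[OF fin, of i M k] Max_ge[OF fin, of i M j] eq unfolding low_def by linarith
    ultimately show ?thesis by simp
  qed
  then show "low M' j < low M j" if "nonzero_col M' j"
    using that Max_in[OF fin, of M' j] by (auto simp: low_def nonzero_col_def)
qed

text \<open>
  \<open>matrix_run f \<kappa> \<Lambda> j M PD\<close>: after some run has processed the first \<open>j\<close> columns, the
  current matrix is \<open>M\<close> and the points added so far are \<open>PD\<close>.
\<close>

inductive matrix_run ::
  "('a \<Rightarrow> real) \<Rightarrow> 'a simplex list \<Rightarrow> 'a simplex list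
     \<Rightarrow> nat \<Rightarrow> bit mat \<Rightarrow> (real \<times> real) multiset \<Rightarrow> bool"
  for f \<kappa> \<Lambda> where
  init: "matrix_run f \<kappa> \<Lambda> 0 (extended_matrix \<kappa> \<Lambda>) {#}"
| column: "matrix_run f \<kappa> \<Lambda> j M PD \<Longrightarrow> j < length \<kappa> + length \<Lambda> \<Longrightarrow> reduce_column j M M' \<Longrightarrow>
    matrix_run f \<kappa> \<Lambda> (Suc j) M'
      (if nonzero_col M' j
       then add_mset (index_value f \<kappa> \<Lambda> (low M' j), index_value f \<kappa> \<Lambda> j) PD
       else PD)"

definition matrix_reduction_outputs ::
  "('a \<Rightarrow> real) \<Rightarrow> 'a simplex list \<Rightarrow> 'a simplex list \<Rightarrow> (real \<times> real) multiset \<Rightarrow> bool" where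
  "matrix_reduction_outputs f \<kappa> \<Lambda> PD \<longleftrightarrow>
     (\<exists>M. matrix_run f \<kappa> \<Lambda> (length \<kappa> + length \<Lambda>) M PD)"


section \<open>Faster Algorithm\<close>

text \<open>
  The Union-Find structure is represented by the set \<open>C\<close> of its blocks, which are the node
  sets of the current connected components. An edge meets either one or two blocks.
\<close>

definition blocks_at :: "'a set set \<Rightarrow> 'a set \<Rightarrow> 'a set set" where
  "blocks_at C e = {B \<in> C. B \<inter> e \<noteq> {}}"

definition earliest_node :: "'a simplex list \<Rightarrow> 'a set \<Rightarrow> 'a" where
  "earliest_node s B = (ARG_MIN (\<lambda>v. position s (Node v)) v. v \<in> B)"

definition dying_node :: "'a simplex list \<Rightarrow> 'a set set \<Rightarrow> 'a set \<Rightarrow> 'a" where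
  "dying_node s C e =
     (ARG_MAX (\<lambda>v. position s (Node v)) v. v \<in> earliest_node s ` blocks_at C e)"

text \<open>
  Inserts the simplices of the third argument, a suffix of the whole sequence \<open>s\<close>, and
  lists the edges that join two components together with the later-born earliest node.
\<close>

fun union_find_pass ::
  "'a simplex list \<Rightarrow> 'a set set \<Rightarrow> 'a simplex list \<Rightarrow> ('a \<times> 'a set) list" where
  "union_find_pass s C [] = []"
| "union_find_pass s C (Node v # xs) = union_find_pass s (insert {v} C) xs"
| "union_find_pass s C (Edge e # xs) =
     (if card (blocks_at C e) = 2
      then (dying_node s C e, e) #
             union_find_pass s (insert (\<Union>(blocks_at C e)) (C - blocks_at C e)) xs
      else union_find_pass s C xs)"

definition merges :: "'a simplex list \<Rightarrow> ('a \<times> 'a set) list" where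
  "merges s = union_find_pass s {} s"

definition zero_dim_PD ::
  "'a set \<Rightarrow> ('a \<Rightarrow> real) \<Rightarrow> 'a simplex list \<Rightarrow> 'a simplex list \<Rightarrow> (real \<times> real) multiset" where
  "zero_dim_PD V f \<kappa> \<Lambda> =
     mset (map (\<lambda>(v, e). (f v, asc_value f (Edge e))) (merges \<kappa>)) +
     mset (map (\<lambda>(v, e). (f v, desc_value f (Edge e))) (merges \<Lambda>)) +
     {#(Min (f ` V), Max (f ` V))#}"

definition negative_edges :: "'a simplex list \<Rightarrow> 'a set set" where
  "negative_edges \<Lambda> = snd ` set (merges \<Lambda>)"

definition positive_edges :: "'a simplex list \<Rightarrow> 'a set list" where
  "positive_edges \<Lambda> = [e. Edge e \<leftarrow> \<Lambda>, e \<notin> negative_edges \<Lambda>]"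

definition tree_path :: "'a set set \<Rightarrow> 'a \<Rightarrow> 'a \<Rightarrow> 'a set set" where
  "tree_path T r u = path_edges (THE p. is_path T u p r)"

definition loop :: "'a set set \<Rightarrow> 'a \<Rightarrow> 'a set \<Rightarrow> 'a set set" where
  "loop T r e = ((\<Union>u\<in>e. tree_path T r u) - (\<Inter>u\<in>e. tree_path T r u)) \<union> {e}"

definition latest_edge :: "'a simplex list \<Rightarrow> 'a set set \<Rightarrow> 'a set" where
  "latest_edge \<kappa> L = (ARG_MAX (\<lambda>e. position \<kappa> (Edge e)) e. e \<in> L)"

text \<open>
  The spanning tree is represented by its edge set \<open>T\<close>. The new edge \<open>e\<close> is added before
  the latest edge of the loop is removed: the two may coincide, and then \<open>T\<close> is unchanged.
\<close>

fun loop_pass ::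
  "('a \<Rightarrow> real) \<Rightarrow> 'a simplex list \<Rightarrow> 'a \<Rightarrow> 'a set set \<Rightarrow> 'a set list \<Rightarrow> (real \<times> real) multiset" where
  "loop_pass f \<kappa> r T [] = {#}"
| "loop_pass f \<kappa> r T (e # es) =
     (let e' = latest_edge \<kappa> (loop T r e)
      in add_mset (asc_value f (Edge e'), desc_value f (Edge e))
           (loop_pass f \<kappa> r (insert e T - {e'}) es))"

definition one_dim_PD ::
  "('a \<Rightarrow> real) \<Rightarrow> 'a simplex list \<Rightarrow> 'a simplex list \<Rightarrow> 'a \<Rightarrow> (real \<times> real) multiset" where
  "one_dim_PD f \<kappa> \<Lambda> r =
     loop_pass f \<kappa> r (negative_edges \<Lambda>) (positive_edges \<Lambda>)"

end

theory Submission
  imports Defs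
begin

text \<open>
  Columns over the two-element field are sets of row indices, and addition is symmetric
  difference. If each column \<open>j\<close> has a representative modulo the span of the earlier columns
  such that the lowest entries of the nonzero representatives are pairwise distinct, then these
  lowest entries do not depend on the choice of representatives. Every run of the matrix
  reduction yields such a system, and so does the faster algorithm: a merging edge yields the
  chain between the earliest nodes of the two components that it joins, and a positive edge of
  the descending pass yields its loop. The loops have distinct latest edges because such an
  edge leaves the spanning tree for good, and all edges of a loop precede the new edge because
  exchanging an edge along a loop keeps the endpoints of every later positive edge linked by
  earlier tree edges.
\<close>

section \<open>Uniqueness of the lowest entries\<close>

text \<open>The two algorithms cannot be matched step by step: the choice of \<open>k\<close> is
  open, and the faster algorithm forms no matrices. So each of the \<open>2m\<close> columns needs a
  representative of its own, also where no point is recorded: ascending nodes, ascending edges that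
  do not merge, and all descending nodes but the first must get the empty one. The point (min, max)
  stems from connectedness. Modulo the ascending edge columns every node row is equivalent to row 0,
  that of the first ascending node; so the first descending node gets \<open>{0}\<close>, and all
  later ones cancel. The sum of the descending edge columns over a set \<open>S\<close> consists of
  \<open>S\<close>, copied by the block P into ascending rows, and of the boundary of
  \<open>S\<close> in the rows from \<open>m\<close> on. Hence a cycle shows its latest ascending
  edge as lowest entry, and any other chain shows a node. Membership in a coset is linear, so
  connectivity and acyclicity are expressed by chains mod 2; actual paths enter only through
  \<open>connected_graph\<close> and \<open>tree_path\<close>.\<close>

fun prefix_span :: "(nat \<Rightarrow> 'b set) \<Rightarrow> nat \<Rightarrow> 'b set set" where
  "prefix_span c 0 = {{}}"
| "prefix_span c (Suc n) = prefix_span c n \<union> (\<lambda>x. sym_diff (c n) x) ` prefix_span c n"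

text \<open>Everything that column \<open>n\<close> can become when reduced columns from its left
  are added to it.\<close>

definition prefix_coset :: "(nat \<Rightarrow> 'b set) \<Rightarrow> nat \<Rightarrow> 'b set set" where
  "prefix_coset c n = (\<lambda>x. sym_diff (c n) x) ` prefix_span c n"

lemma sym_diff_cancel: "sym_diff A (sym_diff A B) = B"
  by auto

lemma sym_diff_left_commute: "sym_diff A (sym_diff B C) = sym_diff B (sym_diff A C)"
  by auto

lemma empty_in_prefix_span: "{} \<in> prefix_span c n"
  by (induction n) auto

lemma prefix_span_sym_diff:
  "x \<in> prefix_span c n \<Longrightarrow> y \<in> prefix_span c n \<Longrightarrow> sym_diff x y \<in> prefix_span c n"
proof (induction n arbitrary: x y)
  case 0
  then show ?case by simp
next
  case (Suc n)
  let ?P = "prefix_span c n"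
  obtain x' where x': "x' \<in> ?P" "x = x' \<or> x = sym_diff (c n) x'"
    using Suc.prems(1) by auto
  obtain y' where y': "y' \<in> ?P" "y = y' \<or> y = sym_diff (c n) y'"
    using Suc.prems(2) by auto
  have s: "sym_diff x' y' \<in> ?P"
    using Suc.IH x' y' by blast
  then have t: "sym_diff x' y' \<in> prefix_span c (Suc n)"
    "sym_diff (c n) (sym_diff x' y') \<in> prefix_span c (Suc n)"
    unfolding prefix_span.simps by (rule UnI1, rule UnI2[OF imageI])
  have "sym_diff (sym_diff (c n) x') y' = sym_diff (c n) (sym_diff x' y')"
    "sym_diff x' (sym_diff (c n) y') = sym_diff (c n) (sym_diff x' y')"
    "sym_diff (sym_diff (c n) x') (sym_diff (c n) y') = sym_diff x' y'"
    by blast+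
  then show ?case
    using t x'(2) y'(2) by metis
qed

lemma prefix_span_mono: "m \<le> n \<Longrightarrow> prefix_span c m \<subseteq> prefix_span c n"
  by (rule lift_Suc_mono_le) auto

lemma prefix_coset_subset: "m < n \<Longrightarrow> prefix_coset c m \<subseteq> prefix_span c n"
  using prefix_span_mono[of "Suc m" n c] by (auto simp: prefix_coset_def)

lemma column_in_prefix_coset: "c n \<in> prefix_coset c n"
  unfolding prefix_coset_def by (rule image_eqI[of _ _ "{}"]) (auto simp: empty_in_prefix_span)

lemma column_in_prefix_span: "m < n \<Longrightarrow> c m \<in> prefix_span c n"
  using column_in_prefix_coset prefix_coset_subset by blast

lemma prefix_coset_iff: "x \<in> prefix_coset c n \<longleftrightarrow> sym_diff (c n) x \<in> prefix_span c n"
proof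
  assume "x \<in> prefix_coset c n"
  then show "sym_diff (c n) x \<in> prefix_span c n"
    unfolding prefix_coset_def using sym_diff_cancel[of "c n"] by fastforce
next
  assume "sym_diff (c n) x \<in> prefix_span c n"
  then show "x \<in> prefix_coset c n"
    unfolding prefix_coset_def
    by (intro image_eqI[of _ _ "sym_diff (c n) x"]) (simp_all only: sym_diff_cancel)
qed

lemma prefix_coset_sym_diff:
  assumes "x \<in> prefix_coset c n" and "y \<in> prefix_span c n"
  shows "sym_diff y x \<in> prefix_coset c n"
  using assms prefix_span_sym_diff[of y c n "sym_diff (c n) x"]
  by (simp only: prefix_coset_iff sym_diff_left_commute[of _ y])

lemma prefix_coset_diff:
  assumes "x \<in> prefix_coset c n" and "y \<in> prefix_coset c n"
  shows "sym_diff x y \<in> prefix_span c n"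
proof -
  have "sym_diff x y = sym_diff (sym_diff (c n) x) (sym_diff (c n) y)"
    by blast
  then show ?thesis
    using assms prefix_span_sym_diff by (metis prefix_coset_iff)
qed

lemma finite_prefix_span:
  "(\<And>k. k < n \<Longrightarrow> finite (c k)) \<Longrightarrow> x \<in> prefix_span c n \<Longrightarrow> finite x"
  by (induction n arbitrary: x) auto

text \<open>Change of basis: the span up to \<open>n\<close> may be generated by any representative
  \<open>b\<close> instead of the raw column \<open>c n\<close>. The inductions can then use a
  column whose lowest entry is known.\<close>

lemma prefix_span_induct_step:
  assumes "b \<in> prefix_coset c n" and "y \<in> prefix_span c (Suc n)"
  obtains "y \<in> prefix_span c n" | z where "z \<in> prefix_span c n" "y = sym_diff b z"
proof -
  have "y \<in> prefix_span c n \<or> y \<in> prefix_coset c n"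
    using assms(2) by (auto simp: prefix_coset_def)
  then show thesis
  proof
    assume "y \<in> prefix_coset c n"
    then have "sym_diff b y \<in> prefix_span c n"
      using assms(1) prefix_coset_diff by blast
    moreover have "y = sym_diff b (sym_diff b y)"
      by (simp only: sym_diff_cancel)
    ultimately show thesis
      using that(2) by blast
  qed (use that in blast)
qed

section \<open>Systems of representatives with distinct lowest entries\<close>

definition lowest :: "'b::linorder set \<Rightarrow> 'b option" where
  "lowest x = (if x = {} then None else Some (Max x))"

lemma lowest_None_iff [simp]: "lowest x = None \<longleftrightarrow> x = {}"
  by (simp add: lowest_def)

lemma lowest_eqI: "finite x \<Longrightarrow> i \<in> x \<Longrightarrow> (\<And>k. k \<in> x \<Longrightarrow> k \<le> i) \<Longrightarrow> lowest x = Some i"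
  by (auto simp: lowest_def intro: Max_eqI)

lemma lowest_sym_diff_less:
  assumes "finite x" "finite y" "lowest x = Some i" "lowest y = Some k" "i < k"
  shows "lowest (sym_diff x y) = Some k"
proof (rule lowest_eqI)
  have i: "i = Max x" "x \<noteq> {}" and k: "k = Max y" "y \<noteq> {}"
    using assms(3,4) by (auto simp: lowest_def split: if_splits)
  have "k \<notin> x"
    using assms(1,5) i by (meson Max_ge leD)
  then show "k \<in> sym_diff x y"
    using k assms(2) by auto
  show "l \<le> k" if "l \<in> sym_diff x y" for l
    using that assms(1,2,5) i k by (metis Diff_iff Max_ge Un_iff less_imp_le order.trans)
qed (use assms in simp)

text \<open>
  A system of representatives as produced by a left-to-right column reduction, described
  only by its lowest entries \<open>g\<close>.
\<close>

definition reduced_lows :: "(nat \<Rightarrow> 'b::linorder set) \<Rightarrow> nat \<Rightarrow> (nat \<Rightarrow> 'b option) \<Rightarrow> bool" where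
  "reduced_lows c n g \<longleftrightarrow>
     (\<forall>j<n. g j \<in> lowest ` prefix_coset c j) \<and>
     (\<forall>j<n. \<forall>i<j. g i \<noteq> None \<longrightarrow> g i \<noteq> g j)"

lemma reduced_lows_le: "reduced_lows c n g \<Longrightarrow> m \<le> n \<Longrightarrow> reduced_lows c m g"
  by (simp add: reduced_lows_def)

text \<open>By change of basis, \<open>y\<close> is a sum of representatives. Their lowest entries
  are distinct, so the largest one among the nonzero summands cannot cancel.\<close>

lemma lowest_in_span:
  assumes "reduced_lows c n g" and "\<And>k. k < n \<Longrightarrow> finite (c k)"
    and "y \<in> prefix_span c n" and "y \<noteq> {}"
  shows "\<exists>k<n. lowest y = g k"
  using assms
proof (induction n arbitrary: y)
  case 0
  then show ?case by simp
next
  case (Suc n)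
  have IH: "\<exists>k<n. lowest z = g k" if "z \<in> prefix_span c n" "z \<noteq> {}" for z
    using Suc.IH[OF reduced_lows_le[OF Suc.prems(1)]] Suc.prems(2) that by simp
  obtain b where b: "b \<in> prefix_coset c n" "lowest b = g n"
    using Suc.prems(1) by (force simp: reduced_lows_def)
  have fin: "finite x" if "x \<in> prefix_span c (Suc n)" for x
    using that Suc.prems(2) by (rule finite_prefix_span[rotated])
  have fb: "finite b"
    using fin b(1) prefix_coset_subset[of n "Suc n" c] by blast
  show ?case
    using b(1) Suc.prems(3)
  proof (cases rule: prefix_span_induct_step)
    case 1
    then show ?thesis using IH Suc.prems(4) less_SucI by blast
  next
    case (2 z)
    show ?thesis
    proof (cases "b = {} \<or> z = {}")
      case True
      then show ?thesis
        using 2 IH[of z] b(2) Suc.prems(4)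
        by (metis Diff_empty Un_empty_left Un_empty_right empty_Diff less_SucI lessI)
    next
      case False
      then obtain k where k: "k < n" "lowest z = g k"
        using IH 2(1) by blast
      have fz: "finite z"
        using fin 2(1) by simp
      obtain i l where i: "lowest b = Some i" and l: "lowest z = Some l"
        using False by (auto simp: lowest_def)
      have "i \<noteq> l"
        using Suc.prems(1) k i l b(2) unfolding reduced_lows_def by (metis lessI option.distinct(1))
      then have "lowest y = lowest b \<or> lowest y = lowest z"
        using lowest_sym_diff_less[OF fb fz i l] lowest_sym_diff_less[OF fz fb l i] i l 2(2)
        by (metis Un_commute linorder_neq_iff)
      then show ?thesis
        using b(2) k less_SucI lessI by metis
    qed
  qed
qed

text \<open>Two representatives of column \<open>j\<close> differ by an element of the earlier span.
  If their lowest entries differed, one of these would be the lowest entry of the difference, hence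
  equal to some \<open>g k\<close> with \<open>k < j\<close>. By induction \<open>g k = h k\<close>,
  so distinctness within \<open>g\<close> or within \<open>h\<close> is violated.\<close>

lemma reduced_lows_unique:
  assumes g: "reduced_lows c n g" and h: "reduced_lows c n h"
    and fin: "\<And>k. k < n \<Longrightarrow> finite (c k)" and "j < n"
  shows "g j = h j"
  using \<open>j < n\<close>
proof (induction j rule: less_induct)
  case (less j)
  obtain x where x: "x \<in> prefix_coset c j" "lowest x = g j"
    using g less.prems unfolding reduced_lows_def by (metis imageE)
  obtain y where y: "y \<in> prefix_coset c j" "lowest y = h j"
    using h less.prems unfolding reduced_lows_def by (metis imageE)
  have fxy: "finite x" "finite y"
    using x(1) y(1) fin less.prems prefix_coset_subset[of j n c] finite_prefix_span[of n c]
    by blast+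
  have z: "sym_diff x y \<in> prefix_span c j"
    using x(1) y(1) by (rule prefix_coset_diff)
  show ?case
  proof (rule ccontr)
    assume ne: "g j \<noteq> h j"
    then have "sym_diff x y \<noteq> {}"
      using x(2) y(2) by (metis Diff_eq_empty_iff Un_empty subset_antisym)
    moreover have "reduced_lows c j g"
      using g less.prems by (simp add: reduced_lows_le)
    ultimately obtain k where k: "k < j" "lowest (sym_diff x y) = g k"
      using lowest_in_span[OF _ _ z] fin less.prems by (meson less_trans)
    have "g k \<noteq> None"
      using k \<open>sym_diff x y \<noteq> {}\<close> by (metis lowest_None_iff)
    moreover have "g k = h k"
      using less.IH[OF k(1)] k(1) less.prems by simp
    ultimately have gk: "g k \<noteq> g j" "g k \<noteq> h j"
      using g h k(1) less.prems unfolding reduced_lows_def by metis+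
    have "lowest (sym_diff x y) = lowest x \<or> lowest (sym_diff x y) = lowest y"
    proof (cases "lowest x"; cases "lowest y")
      fix i l assume "lowest x = Some i" "lowest y = Some l"
      moreover from this have "i \<noteq> l" using ne x y by auto
      ultimately show ?thesis
        using lowest_sym_diff_less[OF fxy] lowest_sym_diff_less[OF fxy(2,1)]
        by (metis Un_commute linorder_neq_iff)
    qed (simp_all)
    then show False
      using gk k(2) x(2) y(2) by auto
  qed
qed

section \<open>Matrix reduction\<close>

definition column_set :: "bit mat \<Rightarrow> nat \<Rightarrow> nat set" where
  "column_set M j = {i. i < dim_row M \<and> M $$ (i, j) = 1}"

lemma finite_column_set [simp]: "finite (column_set M j)"
  by (simp add: column_set_def)

lemma nonzero_col_iff: "nonzero_col M j \<longleftrightarrow> column_set M j \<noteq> {}"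
  by (auto simp: nonzero_col_def column_set_def)

lemma lowest_column_set:
  "lowest (column_set M j) = (if nonzero_col M j then Some (low M j) else None)"
  by (auto simp: nonzero_col_iff lowest_def low_def column_set_def)

lemma column_set_addcol:
  assumes "j < dim_col M"
  shows "column_set (addcol 1 j k M) j = sym_diff (column_set M k) (column_set M j)"
proof -
  have "a + b = 1 \<longleftrightarrow> (a = 1) \<noteq> (b = 1)" for a b :: bit
    by (cases a; cases b) auto
  then show ?thesis
    using assms by (auto simp: column_set_def)
qed

lemma column_set_addcol_other:
  "i < dim_col M \<Longrightarrow> i \<noteq> j \<Longrightarrow> column_set (addcol 1 j k M) i = column_set M i"
  by (auto simp: column_set_def)

text \<open>Invariant of the outer loop. Columns from \<open>j\<close> on must still be the original
  ones, because cosets are formed from original columns.\<close>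

definition partially_reduced :: "(nat \<Rightarrow> nat set) \<Rightarrow> nat \<Rightarrow> nat \<Rightarrow> bit mat \<Rightarrow> bool" where
  "partially_reduced c n j M \<longleftrightarrow> j \<le> n \<and> dim_row M = n \<and> dim_col M = n \<and>
     (\<forall>k<n. if k < j then column_set M k \<in> prefix_coset c k else column_set M k = c k) \<and>
     reduced_lows c j (\<lambda>k. lowest (column_set M k))"

text \<open>An added column \<open>k < j\<close> lies in its own coset and therefore in the span
  before \<open>j\<close>, so column \<open>j\<close> never leaves its coset.\<close>

lemma reduction_steps_invariant:
  assumes "(reduction_step j)\<^sup>*\<^sup>* M M'" and "j < n" and "partially_reduced c n j M"
  shows "dim_row M' = n \<and> dim_col M' = n \<and> column_set M' j \<in> prefix_coset c j \<and>
    (\<forall>k<n. k \<noteq> j \<longrightarrow> column_set M' k = column_set M k)"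
  using assms
proof (induction rule: rtranclp_induct)
  case base
  then show ?case
    by (auto simp: partially_reduced_def column_in_prefix_coset)
next
  case (step M1 M2)
  then have IH: "dim_row M1 = n" "dim_col M1 = n" "column_set M1 j \<in> prefix_coset c j"
    "\<And>k. k < n \<Longrightarrow> k \<noteq> j \<Longrightarrow> column_set M1 k = column_set M k"
    by blast+
  obtain k where k: "k < j" and M2: "M2 = addcol 1 j k M1"
    using step.hyps(2) by (auto simp: reduction_step_def reducible_by_def)
  have "column_set M1 k \<in> prefix_coset c k"
    using IH(4)[of k] k step.prems by (auto simp: partially_reduced_def)
  then have "column_set M1 k \<in> prefix_span c j"
    using k prefix_coset_subset by blast
  then have "column_set M2 j \<in> prefix_coset c j"
    using IH(2,3) step.prems(1) column_set_addcol[of j M1 k] prefix_coset_sym_diff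
    by (simp only: M2)
  then show ?case
    using IH by (simp add: M2 column_set_addcol_other)
qed

text \<open>The exit condition of the inner loop is precisely distinctness of the new lowest entry
  from all earlier ones.\<close>

lemma reduce_column_invariant:
  assumes red: "reduce_column j M M'" and "j < n" and M: "partially_reduced c n j M"
  shows "partially_reduced c n (Suc j) M'"
    and "\<And>k. k < j \<Longrightarrow> column_set M' k = column_set M k"
proof -
  have steps: "(reduction_step j)\<^sup>*\<^sup>* M M'" and irreducible: "\<nexists>k. reducible_by M' j k"
    using red by (simp_all add: reduce_column_def)
  have inv: "dim_row M' = n" "dim_col M' = n" "column_set M' j \<in> prefix_coset c j"
    and old: "\<And>k. k < n \<Longrightarrow> k \<noteq> j \<Longrightarrow> column_set M' k = column_set M k"
    using reduction_steps_invariant[OF steps \<open>j < n\<close> M] by blast+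
  show "\<And>k. k < j \<Longrightarrow> column_set M' k = column_set M k"
    using old \<open>j < n\<close> by simp
  have "lowest (column_set M' i) \<noteq> lowest (column_set M' j)"
    if "i < j" "lowest (column_set M' i) \<noteq> None" for i
  proof
    assume eq: "lowest (column_set M' i) = lowest (column_set M' j)"
    then have "reducible_by M' j i"
      using that by (auto simp: lowest_column_set reducible_by_def split: if_splits)
    then show False
      using irreducible by blast
  qed
  moreover have "reduced_lows c j (\<lambda>k. lowest (column_set M' k))"
    using M old \<open>j < n\<close> by (simp add: partially_reduced_def reduced_lows_def)
  ultimately have "reduced_lows c (Suc j) (\<lambda>k. lowest (column_set M' k))"
    using inv(3) unfolding reduced_lows_def by (simp add: All_less_Suc)
  moreover have "if k < Suc j then column_set M' k \<in> prefix_coset c k else column_set M' k = c k"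
    if "k < n" for k
    using M inv(3) old[of k] that by (cases "k = j") (auto simp: partially_reduced_def)
  ultimately show "partially_reduced c n (Suc j) M'"
    using inv(1,2) \<open>j < n\<close> unfolding partially_reduced_def by simp
qed

lemma reduce_column_exists:
  assumes "j < dim_col M"
  shows "\<exists>M'. reduce_column j M M'"
  using assms
proof (induction "if nonzero_col M j then Suc (low M j) else 0" arbitrary: M rule: less_induct)
  case less
  show ?case
  proof (cases "\<exists>k. reducible_by M j k")
    case False
    then show ?thesis
      by (auto simp: reduce_column_def)
  next
    case True
    then obtain M1 where s: "reduction_step j M M1" and nz: "nonzero_col M j"
      by (auto simp: reduction_step_def reducible_by_def)
    have d: "j < dim_col M1"
      using reduction_step_decreases(1)[OF s less.prems] less.prems by simp
    \<comment> \<open>\<open>Suc\<close> ranks a zero column strictly below a column whose lowest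
      entry is in row 0.\<close>
    have "(if nonzero_col M1 j then Suc (low M1 j) else 0)
      < (if nonzero_col M j then Suc (low M j) else 0)"
      using nz reduction_step_decreases(2)[OF s less.prems] by simp
    from less.hyps[OF this d] obtain M' where "reduce_column j M1 M'" ..
    then show ?thesis
      using s unfolding reduce_column_def by (meson converse_rtranclp_into_rtranclp)
  qed
qed

text \<open>The contribution of one column as a multiset of size at most one, so that the output is
  a plain sum over all columns.\<close>

definition low_point ::
  "('a \<Rightarrow> real) \<Rightarrow> 'a simplex list \<Rightarrow> 'a simplex list \<Rightarrow> nat option \<Rightarrow> nat \<Rightarrow> (real \<times> real) multiset"
  where
  "low_point f \<kappa> \<Lambda> l j =
     (case l of None \<Rightarrow> {#} | Some i \<Rightarrow> {#(index_value f \<kappa> \<Lambda> i, index_value f \<kappa> \<Lambda> j)#})"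

lemma partially_reduced_extended_matrix:
  "partially_reduced (column_set (extended_matrix \<kappa> \<Lambda>)) (length \<kappa> + length \<Lambda>) 0
     (extended_matrix \<kappa> \<Lambda>)"
  by (simp add: partially_reduced_def reduced_lows_def extended_matrix_def boundary_matrix_def)

lemma matrix_run_invariant:
  fixes \<kappa> \<Lambda>
  defines "c \<equiv> column_set (extended_matrix \<kappa> \<Lambda>)" and "n \<equiv> length \<kappa> + length \<Lambda>"
  assumes "matrix_run f \<kappa> \<Lambda> j M PD"
  shows "partially_reduced c n j M \<and>
    PD = (\<Sum>k<j. low_point f \<kappa> \<Lambda> (lowest (column_set M k)) k)"
  using assms(3)
proof (induction rule: matrix_run.induct)
  case init
  then show ?case
    using partially_reduced_extended_matrix by (auto simp: c_def n_def)
next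
  case (column j M PD M')
  have "j < n" and M: "partially_reduced c n j M"
    using column.hyps(2) column.IH by (simp_all add: n_def)
  note inv = reduce_column_invariant(1)[OF column.hyps(3) this]
    and old = reduce_column_invariant(2)[OF column.hyps(3) this]
  have PD: "PD = (\<Sum>k<j. low_point f \<kappa> \<Lambda> (lowest (column_set M' k)) k)"
    using column.IH old by simp
  show ?case
    using inv PD by (auto simp: low_point_def lowest_column_set)
qed

lemma matrix_run_exists:
  "j \<le> length \<kappa> + length \<Lambda> \<Longrightarrow> \<exists>M PD. matrix_run f \<kappa> \<Lambda> j M PD"
proof (induction j)
  case 0
  then show ?case
    using matrix_run.init by blast
next
  case (Suc j)
  then obtain M PD where run: "matrix_run f \<kappa> \<Lambda> j M PD"
    by auto
  then have "j < dim_col M"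
    using matrix_run_invariant[OF run] Suc.prems by (auto simp: partially_reduced_def)
  then obtain M' where "reduce_column j M M'"
    using reduce_column_exists[of j M] by blast
  then show ?case
    using matrix_run.column[OF run _ \<open>reduce_column j M M'\<close>] Suc.prems by (meson Suc_le_lessD)
qed

text \<open>Reduces the theorem to exhibiting a single system \<open>g\<close>. Uniqueness of the
  lowest entries gives one direction; the other also needs that a run exists.\<close>

lemma matrix_reduction_outputs_iff:
  assumes g: "reduced_lows (column_set (extended_matrix \<kappa> \<Lambda>)) (length \<kappa> + length \<Lambda>) g"
  shows "matrix_reduction_outputs f \<kappa> \<Lambda> PD \<longleftrightarrow>
    PD = (\<Sum>j<length \<kappa> + length \<Lambda>. low_point f \<kappa> \<Lambda> (g j) j)"
proof -
  let ?n = "length \<kappa> + length \<Lambda>"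
  have unique: "PD' = (\<Sum>j<?n. low_point f \<kappa> \<Lambda> (g j) j)" if "matrix_run f \<kappa> \<Lambda> ?n M PD'" for M PD'
  proof -
    have "lowest (column_set M j) = g j" if "j < ?n" for j
      using matrix_run_invariant[OF \<open>matrix_run f \<kappa> \<Lambda> ?n M PD'\<close>] that
      by (intro reduced_lows_unique[OF _ g]) (simp_all add: partially_reduced_def)
    then show ?thesis
      using matrix_run_invariant[OF \<open>matrix_run f \<kappa> \<Lambda> ?n M PD'\<close>] by simp
  qed
  obtain M PD' where "matrix_run f \<kappa> \<Lambda> ?n M PD'"
    using matrix_run_exists by blast
  then show ?thesis
    using unique unfolding matrix_reduction_outputs_def by blast
qed

section \<open>Boundaries of edge sets\<close>

text \<open>The simplicial boundary mod 2: the nodes of odd degree. It behaves linearly for finite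
  \<open>S\<close> only, since \<open>card\<close> of an infinite set is 0.\<close>

definition bdry :: "'a set set \<Rightarrow> 'a set" where
  "bdry S = {v. odd (card {e \<in> S. v \<in> e})}"

lemma odd_card_sym_diff:
  assumes "finite A" "finite B"
  shows "odd (card (sym_diff A B)) \<longleftrightarrow> odd (card A) \<noteq> odd (card B)"
proof -
  have "card (sym_diff A B) = card (A - B) + card (B - A)"
    using assms by (intro card_Un_disjoint) auto
  moreover have "card A = card (A - B) + card (A \<inter> B)"
    using assms by (subst card_Un_disjoint[symmetric]) (auto intro: arg_cong[of _ _ card])
  moreover have "card B = card (B - A) + card (A \<inter> B)"
    using assms by (subst card_Un_disjoint[symmetric]) (auto intro: arg_cong[of _ _ card])
  ultimately show ?thesis
    by presburger
qed

lemma bdry_empty [simp]: "bdry {} = {}"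
  by (simp add: bdry_def)

lemma bdry_singleton [simp]: "bdry {e} = e"
proof -
  have "{e' \<in> {e}. v \<in> e'} = (if v \<in> e then {e} else {})" for v
    by auto
  then show ?thesis
    by (simp add: bdry_def)
qed

lemma bdry_sym_diff:
  assumes "finite S" "finite T"
  shows "bdry (sym_diff S T) = sym_diff (bdry S) (bdry T)"
proof -
  have eq: "{e \<in> sym_diff S T. v \<in> e} = sym_diff {e \<in> S. v \<in> e} {e \<in> T. v \<in> e}" for v
    by blast
  have "odd (card {e \<in> sym_diff S T. v \<in> e}) \<longleftrightarrow>
    odd (card {e \<in> S. v \<in> e}) \<noteq> odd (card {e \<in> T. v \<in> e})" for v
    unfolding eq by (rule odd_card_sym_diff) (use assms in simp_all)
  then show ?thesis
    unfolding bdry_def by blast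
qed

lemma bdry_insert:
  assumes "finite S" "e \<notin> S"
  shows "bdry (insert e S) = sym_diff e (bdry S)"
proof -
  have "insert e S = sym_diff {e} S"
    using assms(2) by blast
  then show ?thesis
    using bdry_sym_diff[of "{e}" S] assms(1) by simp
qed

text \<open>A mod 2 handshake count: the parity of the boundary inside \<open>B\<close> is the sum
  of the parities of the edges inside \<open>B\<close>. This is the cut argument used below to show
  that no chain leaves a union of components.\<close>

lemma even_card_bdry_Int:
  assumes "finite S" "\<And>e. e \<in> S \<Longrightarrow> finite e \<and> even (card (e \<inter> B))"
  shows "finite (bdry S) \<and> even (card (bdry S \<inter> B))"
  using assms
proof (induction S rule: finite_induct)
  case empty
  then show ?case by simp
next
  case (insert e S)
  have "bdry (insert e S) \<inter> B = sym_diff (e \<inter> B) (bdry S \<inter> B)"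
    using bdry_insert[OF insert.hyps(1,2)] by auto
  moreover have "finite (bdry (insert e S))"
    using bdry_insert[OF insert.hyps(1,2)] insert by auto
  ultimately show ?case
    using insert.IH insert.prems odd_card_sym_diff[of "e \<inter> B" "bdry S \<inter> B"] by simp
qed

section \<open>Forests and connectivity in terms of chains mod 2\<close>

definition acyclic_edges :: "'a set set \<Rightarrow> bool" where
  "acyclic_edges T \<longleftrightarrow> (\<forall>S\<subseteq>T. finite S \<longrightarrow> bdry S = {} \<longrightarrow> S = {})"

text \<open>\<open>sym_diff {u} {v}\<close> instead of \<open>{u, v}\<close> makes the case
  \<open>u = v\<close> consistent: the boundary is then empty.\<close>

definition linked :: "'a set set \<Rightarrow> 'a \<Rightarrow> 'a \<Rightarrow> bool" where
  "linked T u v \<longleftrightarrow> (\<exists>S\<subseteq>T. finite S \<and> bdry S = sym_diff {u} {v})"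

lemma linkedI: "S \<subseteq> T \<Longrightarrow> finite S \<Longrightarrow> bdry S = sym_diff {u} {v} \<Longrightarrow> linked T u v"
  unfolding linked_def by blast

lemma linkedE:
  assumes "linked T u v"
  obtains S where "S \<subseteq> T" "finite S" "bdry S = sym_diff {u} {v}"
  using assms unfolding linked_def by blast

lemma linked_refl [simp]: "linked T u u"
  by (rule linkedI[of "{}"]) simp_all

lemma linked_sym: "linked T u v \<Longrightarrow> linked T v u"
  unfolding linked_def by (simp add: Un_commute)

lemma linked_trans:
  assumes "linked T u v" "linked T v w"
  shows "linked T u w"
proof -
  obtain S where S: "S \<subseteq> T" "finite S" "bdry S = sym_diff {u} {v}"
    using assms(1) by (rule linkedE)
  obtain S' where S': "S' \<subseteq> T" "finite S'" "bdry S' = sym_diff {v} {w}"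
    using assms(2) by (rule linkedE)
  have "bdry (sym_diff S S') = sym_diff {u} {w}"
    unfolding bdry_sym_diff[OF S(2) S'(2)] S(3) S'(3) by auto
  moreover have "sym_diff S S' \<subseteq> T"
    using S(1) S'(1) by (simp add: subset_iff)
  moreover have "finite (sym_diff S S')"
    using S(2) S'(2) by simp
  ultimately show ?thesis
    by (rule linkedI[rotated 2])
qed

lemma linked_mono: "linked S u v \<Longrightarrow> S \<subseteq> T \<Longrightarrow> linked T u v"
  unfolding linked_def by (meson order_trans)

lemma linked_edge:
  assumes "e \<in> T" "card e = 2" "u \<in> e" "v \<in> e"
  shows "linked T u v"
proof (cases "u = v")
  case False
  then have "e = {u, v}"
    using assms(2-4) by (metis card_2_iff doubleton_eq_iff insertE singletonD)
  then have "bdry {e} = sym_diff {u} {v}"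
    using False by auto
  then show ?thesis
    using assms(1) by (intro linkedI[of "{e}"]) simp_all
qed simp

text \<open>Every edge of the chain in \<open>S\<close> is replaced by a chain in \<open>T\<close>
  with the same boundary, and these are added up.\<close>

lemma linked_lift:
  assumes "linked S u v" "\<And>e. e \<in> S \<Longrightarrow> \<exists>a b. e = {a, b} \<and> a \<noteq> b \<and> linked T a b"
  shows "linked T u v"
proof -
  have *: "\<exists>R\<subseteq>T. finite R \<and> bdry R = bdry Q" if "finite Q" "Q \<subseteq> S" for Q
    using that
  proof (induction Q rule: finite_induct)
    case empty
    then show ?case
      by (intro exI[of _ "{}"]) auto
  next
    case (insert e Q)
    then obtain R where R: "R \<subseteq> T" "finite R" "bdry R = bdry Q"
      by auto
    obtain a b where ab: "e = {a, b}" "a \<noteq> b" "linked T a b"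
      using assms(2)[of e] insert.prems by blast
    then obtain R' where R': "R' \<subseteq> T" "finite R'" "bdry R' = sym_diff {a} {b}"
      by (auto elim: linkedE)
    have "bdry R' = e"
      using R'(3) ab by auto
    then have "bdry (sym_diff R' R) = bdry (insert e Q)"
      using R insert.hyps by (simp add: bdry_sym_diff[OF R'(2) R(2)] bdry_insert)
    moreover have "sym_diff R' R \<subseteq> T"
      using R(1) R'(1) by (simp add: subset_iff)
    moreover have "finite (sym_diff R' R)"
      using R(2) R'(2) by simp
    ultimately show ?case
      by metis
  qed
  then show ?thesis
    using assms(1) by (elim linkedE) (metis linkedI)
qed

section \<open>Paths and the chains they carry\<close>

lemma path_edges_subset: "e \<in> path_edges p \<Longrightarrow> e \<subseteq> set p"
  by (induction p rule: path_edges.induct) auto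

lemma finite_path_edges [simp]: "finite (path_edges p)"
  by (induction p rule: path_edges.induct) auto

lemma path_edges_append: "path_edges q \<subseteq> path_edges (xs @ q)"
proof (induction xs)
  case (Cons x xs)
  have "path_edges ys \<subseteq> path_edges (x # ys)" for ys
    by (cases ys) auto
  then show ?case
    using Cons by (metis append_Cons order_trans)
qed simp

lemma bdry_path_edges:
  "p \<noteq> [] \<Longrightarrow> distinct p \<Longrightarrow> bdry (path_edges p) = sym_diff {hd p} {last p}"
proof (induction p rule: path_edges.induct)
  case (1 u v p)
  have "{u, v} \<notin> path_edges (v # p)"
    using path_edges_subset[of "{u, v}" "v # p"] 1(3) by auto
  then have "bdry (path_edges (u # v # p)) = sym_diff {u, v} (sym_diff {v} {last (v # p)})"
    using 1 by (simp add: bdry_insert del: last.simps)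
  also have "\<dots> = sym_diff {u} {last (v # p)}"
    using 1(3) by (cases "p = []") auto
  finally show ?case by simp
qed auto

text \<open>The first edge is the only one that contains the start node, so a simple path can be
  read off its edge set. This passes from uniqueness of chains to uniqueness of node lists, as the
  \<open>THE\<close> in \<open>tree_path\<close> requires.\<close>

lemma path_edges_inj:
  assumes "path_edges p = path_edges q" "distinct p" "distinct q" "p \<noteq> []" "q \<noteq> []" "hd p = hd q"
  shows "p = q"
  using assms
proof (induction p arbitrary: q rule: path_edges.induct)
  case (1 u v p)
  then obtain q' where q': "q = u # q'"
    by (cases q) auto
  have notin: "u \<notin> e" if "e \<in> path_edges p'" "u \<notin> set p'" for e p'
    using that path_edges_subset by blast
  have "q' \<noteq> []"
    using 1 q' by auto
  then obtain w q'' where q'': "q' = w # q''"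
    by (cases q') auto
  have p: "u \<notin> \<Union>(path_edges (v # p))" and q: "u \<notin> \<Union>(path_edges (w # q''))"
    using notin 1(3,4) q' q'' by (metis UnionE distinct.simps(2))+
  have eq: "insert {u, v} (path_edges (v # p)) = insert {u, w} (path_edges (w # q''))"
    using 1(2) q' q'' by simp
  have notin_edges: "{u, v} \<notin> path_edges (v # p)" "{u, v} \<notin> path_edges (w # q'')"
    using p q by (meson UnionI insertI1)+
  have "{u, v} \<in> insert {u, w} (path_edges (w # q''))"
    unfolding eq[symmetric] by (rule insertI1)
  then have "{u, v} = {u, w}"
    using notin_edges(2) by (meson insertE)
  then have vw: "v = w"
    by (metis doubleton_eq_iff)
  then have "path_edges (v # p) = path_edges (w # q'')"
    using eq notin_edges by (metis insert_ident)
  then have "v # p = w # q''"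
    using "1.IH"[of "w # q''"] "1.prems"(2,3) q' q'' vw by simp
  then show ?case
    using q' q'' by simp
next
  case ("2_1")
  then show ?case by simp
next
  case ("2_2" u)
  then show ?case
    by (cases q rule: path_edges.cases) auto
qed

definition edge_set :: "'a set set \<Rightarrow> bool" where
  "edge_set T \<longleftrightarrow> (\<forall>e\<in>T. card e = 2)"

lemma is_path_linked: "is_path T u p v \<Longrightarrow> linked T u v"
  using bdry_path_edges[of p] by (intro linkedI[of "path_edges p"]) (simp_all add: is_path_def)

lemma is_path_Cons:
  assumes "is_path T v p w" "{u, v} \<in> T"
  shows "\<exists>q. is_path T u q w"
proof (cases "u \<in> set p")
  \<comment> \<open>Prepending \<open>u\<close> would repeat a node; the tail of \<open>p\<close>
    from \<open>u\<close> on is already a path.\<close>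
  case True
  then obtain xs ys where "p = xs @ u # ys"
    by (meson split_list)
  then have "is_path T u (u # ys) w"
    using assms(1) path_edges_append[of "u # ys" xs] by (auto simp: is_path_def)
  then show ?thesis ..
next
  case False
  have "is_path T u (u # p) w"
    using assms False by (cases p) (auto simp: is_path_def)
  then show ?thesis ..
qed

text \<open>Let \<open>B\<close> collect the nodes with a path to \<open>v\<close>. Each edge of
  \<open>T\<close> has both endpoints in \<open>B\<close> or none, so a chain from \<open>u\<close>
  to \<open>v\<close> has even boundary in \<open>B\<close>. With \<open>v\<close> in
  \<open>B\<close> and \<open>u\<close> outside, that boundary would be \<open>{v}\<close>.\<close>

lemma linked_is_path:
  assumes "edge_set T" "linked T u v"
  shows "\<exists>p. is_path T u p v"
proof (rule ccontr)
  define B where "B = {w. \<exists>p. is_path T w p v}"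
  assume "\<nexists>p. is_path T u p v"
  then have u: "u \<notin> B"
    by (simp add: B_def)
  have v: "v \<in> B"
    unfolding B_def by (auto simp: is_path_def intro!: exI[of _ "[v]"])
  obtain S where S: "S \<subseteq> T" "finite S" "bdry S = sym_diff {u} {v}"
    using assms(2) by (rule linkedE)
  have "finite e \<and> even (card (e \<inter> B))" if "e \<in> S" for e
  proof -
    have e: "e \<in> T" "card e = 2"
      using that S(1) assms(1) by (auto simp: edge_set_def)
    then obtain a b where ab: "e = {a, b}" "a \<noteq> b"
      by (meson card_2_iff)
    have "a \<in> B \<longleftrightarrow> b \<in> B"
      using is_path_Cons[of T a _ v b] is_path_Cons[of T b _ v a] e(1) ab(1)
      unfolding B_def by (auto simp: insert_commute)
    then have "e \<inter> B = e \<or> e \<inter> B = {}"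
      using ab by auto
    then have "even (card (e \<inter> B))"
      using e(2) by (elim disjE) simp_all
    then show ?thesis
      using ab(1) by simp
  qed
  then have "even (card (bdry S \<inter> B))"
    using even_card_bdry_Int S(2) by blast
  moreover have "bdry S \<inter> B = {v}"
    using S(3) u v by auto
  ultimately show False
    by simp
qed

lemma acyclic_bdry_inj:
  assumes "acyclic_edges T" "S \<subseteq> T" "S' \<subseteq> T" "finite S" "finite S'" "bdry S = bdry S'"
  shows "S = S'"
proof -
  have "bdry (sym_diff S S') = {}"
    using assms(4-6) by (simp add: bdry_sym_diff)
  moreover have "sym_diff S S' \<subseteq> T"
    using assms(2,3) by (simp add: subset_iff)
  moreover have "finite (sym_diff S S')"
    using assms(4,5) by simp
  ultimately have "sym_diff S S' = {}"
    using assms(1) unfolding acyclic_edges_def by meson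
  then show ?thesis
    by blast
qed

text \<open>Two paths from \<open>u\<close> to \<open>r\<close> have the same boundary, hence by
  acyclicity the same edges, hence they coincide; so the description in \<open>tree_path\<close> is
  proper.\<close>

lemma tree_path_properties:
  assumes "edge_set T" "acyclic_edges T" "linked T u r"
  shows "tree_path T r u \<subseteq> T \<and> finite (tree_path T r u) \<and> bdry (tree_path T r u) = sym_diff {u} {r}"
proof -
  obtain p where p: "is_path T u p r"
    using linked_is_path[OF assms(1,3)] ..
  have "q = p" if q: "is_path T u q r" for q
  proof (rule path_edges_inj)
    show "path_edges q = path_edges p"
      using acyclic_bdry_inj[OF assms(2), of "path_edges q" "path_edges p"] p q
        bdry_path_edges[of p] bdry_path_edges[of q]
      by (simp add: is_path_def)
  qed (use p q in \<open>simp_all add: is_path_def\<close>)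
  then have "(THE q. is_path T u q r) = p"
    using p by (rule the_equality[rotated])
  then show ?thesis
    using p bdry_path_edges[of p] by (simp add: tree_path_def is_path_def)
qed

text \<open>In the symmetric difference of the two root paths the root cancels, leaving boundary
  \<open>e\<close>. By acyclicity only one chain in \<open>T\<close> has this boundary, so any chain
  \<open>S\<close> obtained elsewhere is the loop without \<open>e\<close>, whatever the
  root.\<close>

lemma loop_eq:
  assumes "edge_set T" "acyclic_edges T" "\<And>u. u \<in> e \<Longrightarrow> linked T u r" "card e = 2"
    and S: "S \<subseteq> T" "finite S" "bdry S = e"
  shows "loop T r e = insert e S"
proof -
  obtain u v where e: "e = {u, v}" "u \<noteq> v"
    using assms(4) by (meson card_2_iff)
  note u = tree_path_properties[OF assms(1,2,3), of u] and v = tree_path_properties[OF assms(1,2,3), of v]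
  have "bdry (sym_diff (tree_path T r u) (tree_path T r v)) = sym_diff (sym_diff {u} {r}) (sym_diff {v} {r})"
    using u v e by (simp add: bdry_sym_diff)
  also have "\<dots> = e"
    using e by auto
  finally have "sym_diff (tree_path T r u) (tree_path T r v) = S"
    using u v e S by (intro acyclic_bdry_inj[OF assms(2)]) (simp_all add: subset_iff)
  then show ?thesis
    unfolding loop_def e by auto
qed

section \<open>Union-Find\<close>

locale ordered_graph =
  fixes V :: "'a set" and E :: "'a set set" and s :: "'a simplex list"
  assumes graph: "simple_graph V E" and order: "simplex_order V E s"
begin

abbreviation pos :: "'a simplex \<Rightarrow> nat" where
  "pos \<equiv> position s"

text \<open>\<open>position\<close> is unspecified for sets that are not edges, so this set is
  meaningful only for members of \<open>E\<close>.\<close>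

definition before :: "'a set \<Rightarrow> 'a set set" where
  "before e = {e'. pos (Edge e') < pos (Edge e)}"

lemma distinct_order: "distinct s" and set_order: "set s = simplices V E"
  using order by (simp_all add: simplex_order_def)

lemma position_nth [simp]: "i < length s \<Longrightarrow> pos (s ! i) = i"
  unfolding position_def using distinct_order
  by (intro Least_equality) (auto simp: nth_eq_iff_index_eq)

lemma position_less: "x \<in> set s \<Longrightarrow> pos x < length s"
  and nth_position: "x \<in> set s \<Longrightarrow> s ! pos x = x"
  by (auto simp: in_set_conv_nth)

lemma position_inj: "x \<in> set s \<Longrightarrow> y \<in> set s \<Longrightarrow> pos x = pos y \<Longrightarrow> x = y"
  by (metis nth_position)

lemma Node_in_order [simp]: "Node v \<in> set s \<longleftrightarrow> v \<in> V"
  and Edge_in_order [simp]: "Edge e \<in> set s \<longleftrightarrow> e \<in> E"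
  by (auto simp: set_order simplices_def)

lemma edge_card: "e \<in> E \<Longrightarrow> card e = 2"
  and edge_subset: "e \<in> E \<Longrightarrow> e \<subseteq> V"
  and finite_V: "finite V"
  using graph by (auto simp: simple_graph_def)

lemma finite_E: "finite E"
  using finite_subset[of E "Pow V"] edge_subset finite_V by blast

lemma incident_position_less:
  assumes "e \<in> E" "v \<in> e"
  shows "pos (Node v) < pos (Edge e)"
proof -
  have v: "Node v \<in> set s" and e: "Edge e \<in> set s"
    using assms edge_subset by auto
  have "incident (s ! pos (Node v)) (s ! pos (Edge e))"
    using assms by (simp add: nth_position[OF v] nth_position[OF e])
  then show ?thesis
    using order position_less[OF v] position_less[OF e] by (simp add: simplex_order_def)
qed

lemma position_prefix:
  assumes s: "s = ys @ xs"
  shows "x \<in> set ys \<Longrightarrow> pos x < length ys"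
    and "x \<in> set s \<Longrightarrow> pos x < length ys \<Longrightarrow> x \<in> set ys"
proof -
  assume "x \<in> set ys"
  then obtain i where i: "i < length ys" "ys ! i = x"
    by (auto simp: in_set_conv_nth)
  have "s ! i = x" "i < length s"
    unfolding s using i by (simp_all add: nth_append)
  then show "pos x < length ys"
    using position_nth[of i] i(1) by simp
next
  assume x: "x \<in> set s" "pos x < length ys"
  have "s ! pos x = ys ! pos x"
    using x(2) by (subst s) (simp add: nth_append)
  then show "x \<in> set ys"
    using nth_position[OF x(1)] nth_mem[OF x(2)] by simp
qed

lemma position_next:
  assumes "s = ys @ x # xs"
  shows "pos x = length ys"
  using position_nth[of "length ys"] assms by simp

lemma earliest_node_in: "B \<noteq> {} \<Longrightarrow> earliest_node s B \<in> B"
  and earliest_node_le: "v \<in> B \<Longrightarrow> pos (Node (earliest_node s B)) \<le> pos (Node v)"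
  using arg_min_nat_lemma[of "\<lambda>v. v \<in> B" _ "\<lambda>v. pos (Node v)"]
  by (auto simp: earliest_node_def)

end

text \<open>
  Invariant of the Union-Find pass after the prefix \<open>ys\<close>, with current blocks \<open>C\<close> and
  recorded merges \<open>L\<close>. A set \<open>S\<close> of edges with \<open>bdry S = e\<close> is a chain linking the endpoints of \<open>e\<close>.
\<close>

locale union_find_state = ordered_graph +
  fixes ys :: "'a simplex list" and C :: "'a set set" and L :: "('a \<times> 'a set) list"
  assumes Union_blocks: "\<Union>C = {v. Node v \<in> set ys}"
    and blocks_disjoint: "\<And>A B. A \<in> C \<Longrightarrow> B \<in> C \<Longrightarrow> A \<noteq> B \<Longrightarrow> A \<inter> B = {}"
    and blocks_nonempty: "{} \<notin> C"
    and blocks_linked: "\<And>B u v. B \<in> C \<Longrightarrow> u \<in> B \<Longrightarrow> v \<in> B \<Longrightarrow> linked (snd ` set L) u v"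
    and edges_in_blocks: "\<And>e. Edge e \<in> set ys \<Longrightarrow> \<exists>B\<in>C. e \<subseteq> B"
    and merging_edges: "\<And>e. e \<in> snd ` set L \<Longrightarrow> Edge e \<in> set ys"
    and merging_acyclic: "acyclic_edges (snd ` set L)"
    and distinct_snd: "distinct (map snd L)"
    and distinct_fst: "distinct (map fst L)"
    and dead_nodes: "fst ` set L \<subseteq> \<Union>C"
    and earliest_alive: "\<And>B. B \<in> C \<Longrightarrow> earliest_node s B \<notin> fst ` set L"
    and merging_chain: "\<And>v e. (v, e) \<in> set L \<Longrightarrow>
      \<exists>w S. w \<in> V \<and> pos (Node w) < pos (Node v) \<and> S \<subseteq> snd ` set L \<inter> before e \<and> finite S \<and>
        bdry (insert e S) = {v, w}"
    and nonmerging_chain: "\<And>e. Edge e \<in> set ys \<Longrightarrow> e \<notin> snd ` set L \<Longrightarrow>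
      \<exists>S \<subseteq> snd ` set L \<inter> before e. finite S \<and> bdry S = e"

context ordered_graph
begin

lemma union_find_state_init: "union_find_state V E s [] {} []"
  by unfold_locales (simp_all add: acyclic_edges_def)

lemma union_find_state_Node:
  assumes "union_find_state V E s ys C L" and s: "s = ys @ Node v # xs"
  shows "union_find_state V E s (ys @ [Node v]) (insert {v} C) L"
proof -
  interpret union_find_state V E s ys C L by fact
  have v: "v \<notin> \<Union>C"
    using distinct_order s by (simp add: Union_blocks)
  have earliest: "earliest_node s {v} = v"
    using earliest_node_in[of "{v}"] by simp
  show ?thesis
  proof unfold_locales
    show "\<Union>(insert {v} C) = {u. Node u \<in> set (ys @ [Node v])}"
      by (auto simp: Union_blocks)
    show "A \<inter> B = {}" if "A \<in> insert {v} C" "B \<in> insert {v} C" "A \<noteq> B" for A B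
      using that v blocks_disjoint[of A B] by blast
    show "{} \<notin> insert {v} C"
      using blocks_nonempty by simp
    show "linked (snd ` set L) u w" if "B \<in> insert {v} C" "u \<in> B" "w \<in> B" for B u w
      using that blocks_linked[of B u w] by auto
    show "\<exists>B\<in>insert {v} C. e \<subseteq> B" if "Edge e \<in> set (ys @ [Node v])" for e
      using that edges_in_blocks[of e] by auto
    show "Edge e \<in> set (ys @ [Node v])" if "e \<in> snd ` set L" for e
      using that merging_edges[of e] by auto
    show "acyclic_edges (snd ` set L)" "distinct (map snd L)" "distinct (map fst L)"
      by (fact merging_acyclic distinct_snd distinct_fst)+
    show "fst ` set L \<subseteq> \<Union>(insert {v} C)"
      using dead_nodes by auto
    \<comment> \<open>The new singleton block is alive: dead nodes all lie in old blocks, and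
      \<open>v\<close> lies in none.\<close>
    show "earliest_node s B \<notin> fst ` set L" if "B \<in> insert {v} C" for B
    proof (cases "B = {v}")
      case True
      then show ?thesis
        using earliest v subsetD[OF dead_nodes] by metis
    next
      case False
      then show ?thesis
        using that earliest_alive[of B] by simp
    qed
    show "\<exists>w S. w \<in> V \<and> pos (Node w) < pos (Node u) \<and> S \<subseteq> snd ` set L \<inter> before e \<and> finite S \<and>
        bdry (insert e S) = {u, w}" if "(u, e) \<in> set L" for u e
      using that by (rule merging_chain)
    show "\<exists>S\<subseteq>snd ` set L \<inter> before e. finite S \<and> bdry S = e"
      if "Edge e \<in> set (ys @ [Node v])" "e \<notin> snd ` set L" for e
      using that nonmerging_chain[of e] by simp
  qed
qed

text \<open>Endpoints are inserted before their edge, so each lies in some block.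
  \<open>A = B\<close> is allowed; it is the case without a merge.\<close>

lemma edge_blocks:
  assumes "union_find_state V E s ys C L" and s: "s = ys @ Edge e # xs"
  obtains a b A B where "e = {a, b}" "a \<noteq> b" "A \<in> C" "B \<in> C" "a \<in> A" "b \<in> B"
    "blocks_at C e = {A, B}" "e \<in> E" "Edge e \<notin> set ys" "\<And>e'. Edge e' \<in> set ys \<Longrightarrow> e' \<in> before e"
proof -
  interpret union_find_state V E s ys C L by fact
  have "Edge e \<in> set s"
    using s by simp
  then have e: "e \<in> E"
    by simp
  then obtain a b where ab: "e = {a, b}" "a \<noteq> b"
    using edge_card by (meson card_2_iff)
  have node: "u \<in> \<Union>C" if "u \<in> e" for u
  proof -
    have "Node u \<in> set s" "pos (Node u) < length ys"
      using incident_position_less[OF e that] position_next[OF s] e that edge_subset by auto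
    then show ?thesis
      using position_prefix(2)[OF s] by (simp add: Union_blocks)
  qed
  have "a \<in> \<Union>C" "b \<in> \<Union>C"
    using node ab(1) by simp_all
  then obtain A B where AB: "A \<in> C" "B \<in> C" "a \<in> A" "b \<in> B"
    by (elim UnionE)
  have blocks_iff: "D \<in> blocks_at C e \<longleftrightarrow> D \<in> {A, B}" for D
    using AB ab blocks_disjoint[of D A] blocks_disjoint[of D B] unfolding blocks_at_def by auto
  have blocks: "blocks_at C e = {A, B}"
    by (intro equalityI subsetI) (simp_all only: blocks_iff)
  have bef: "e' \<in> before e" if "Edge e' \<in> set ys" for e'
    using that position_prefix(1)[OF s] position_next[OF s] by (simp add: before_def)
  have new: "Edge e \<notin> set ys"
    using distinct_order s by simp
  show thesis
    by (rule that[OF ab AB blocks e new bef])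
qed

lemma subset_insert_Int: "S \<subseteq> N \<inter> F \<Longrightarrow> S \<subseteq> insert e N \<inter> F"
  by blast

text \<open>The dying node is the earliest of its old block, so it was alive and is not recorded
  twice. The other earliest node becomes the earliest of the union and stays alive.\<close>

lemma union_find_state_join:
  assumes "union_find_state V E s ys C L" and s: "s = ys @ Edge e # xs"
    and two: "card (blocks_at C e) = 2"
  shows "union_find_state V E s (ys @ [Edge e])
    (insert (\<Union>(blocks_at C e)) (C - blocks_at C e)) (L @ [(dying_node s C e, e)])"
proof -
  interpret union_find_state V E s ys C L by fact
  let ?N = "snd ` set L"
  obtain a b A B where ab: "e = {a, b}" "a \<noteq> b" and AB: "A \<in> C" "B \<in> C" "a \<in> A" "b \<in> B"
    and blocks: "blocks_at C e = {A, B}" and e: "e \<in> E" "Edge e \<notin> set ys"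
    and bef: "\<And>e'. Edge e' \<in> set ys \<Longrightarrow> e' \<in> before e"
    by (rule edge_blocks[OF assms(1) s]) (rule that)
  have "A \<noteq> B"
    using two blocks by auto
  then have disj: "A \<inter> B = {}"
    using AB blocks_disjoint by simp
  have eN: "e \<notin> ?N"
    using e(2) merging_edges by blast
  define p q where "p = earliest_node s A" and "q = earliest_node s B"
  have p: "p \<in> A" and q: "q \<in> B"
    using earliest_node_in[of A] earliest_node_in[of B] AB by (auto simp: p_def q_def)
  have pq: "p \<noteq> q" and V: "p \<in> V" "q \<in> V"
  proof -
    show "p \<noteq> q" using p q disj by auto
    have "{v. Node v \<in> set ys} \<subseteq> V"
      using s by (auto simp flip: Node_in_order)
    then show "p \<in> V" "q \<in> V"
      using p q AB Union_blocks by blast+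
  qed
  have pos_pq: "pos (Node p) \<noteq> pos (Node q)"
    using position_inj[of "Node p" "Node q"] V pq by auto
  define d where "d = dying_node s C e"
  have d: "d \<in> {p, q}" "pos (Node p) \<le> pos (Node d)" "pos (Node q) \<le> pos (Node d)"
  proof -
    have d_def': "d = arg_max (\<lambda>v. pos (Node v)) (\<lambda>v. v \<in> {p, q})"
      unfolding d_def dying_node_def blocks by (simp add: p_def q_def)
    \<comment> \<open>An arbitrary strict upper bound for both positions is supplied so that the
      maximum is known to exist.\<close>
    have "d \<in> {p, q} \<and> (\<forall>v. v \<in> {p, q} \<longrightarrow> pos (Node v) \<le> pos (Node d))"
      unfolding d_def'
      by (rule arg_max_nat_lemma[of _ p _ "Suc (pos (Node p) + pos (Node q))"]) auto
    then show "d \<in> {p, q}" "pos (Node p) \<le> pos (Node d)" "pos (Node q) \<le> pos (Node d)"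
      by simp_all
  qed
  define w where "w = (if d = p then q else p)"
  have w: "{d, w} = {p, q}" "pos (Node w) < pos (Node d)" "w \<in> V"
    using d pq pos_pq V by (auto simp: w_def)
  have dAB: "d \<in> A \<union> B"
    using d(1) p q by auto
  let ?L = "L @ [(d, e)]" and ?C = "insert (A \<union> B) (C - {A, B})"
  have N': "snd ` set ?L = insert e ?N" and D': "fst ` set ?L = insert d (fst ` set L)"
    by auto
  have mono: "linked (insert e ?N) u v" if "linked ?N u v" for u v
    using that by (rule linked_mono) blast
  have linked_a: "linked (insert e ?N) u a" if u: "u \<in> A \<union> B" for u
  proof (cases "u \<in> A")
    case True
    then show ?thesis using mono blocks_linked[of A u a] AB by simp
  next
    case False
    then have "linked (insert e ?N) u b"
      using mono blocks_linked[of B u b] AB u by simp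
    moreover have "linked (insert e ?N) b a"
      using edge_card[OF e(1)] ab(1) by (intro linked_edge[of e]) simp_all
    ultimately show ?thesis by (rule linked_trans)
  qed
  \<comment> \<open>Go from \<open>p\<close> to \<open>a\<close> inside \<open>A\<close>, cross
    \<open>e\<close>, and go from \<open>b\<close> to \<open>q\<close> inside
    \<open>B\<close>.\<close>
  have chain: "\<exists>S. S \<subseteq> ?N \<and> finite S \<and> bdry (insert e S) = {d, w}"
  proof -
    obtain S1 where S1: "S1 \<subseteq> ?N" "finite S1" "bdry S1 = sym_diff {p} {a}"
      using blocks_linked[of A p a] p AB by (auto elim: linkedE)
    obtain S2 where S2: "S2 \<subseteq> ?N" "finite S2" "bdry S2 = sym_diff {q} {b}"
      using blocks_linked[of B q b] q AB by (auto elim: linkedE)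
    have sub: "sym_diff S1 S2 \<subseteq> ?N"
      using S1(1) S2(1) by (simp add: subset_iff)
    have fin: "finite (sym_diff S1 S2)"
      using S1(2) S2(2) by simp
    have "bdry (insert e (sym_diff S1 S2)) = sym_diff {a, b} (sym_diff (sym_diff {p} {a}) (sym_diff {q} {b}))"
      using sub eN ab(1) fin S1(3) S2(3)
      by (subst bdry_insert) (auto simp only: bdry_sym_diff[OF S1(2) S2(2)])
    also have "\<dots> = {p, q}"
      using ab(2) pq by auto
    finally show ?thesis
      using sub fin w(1) by metis
  qed
  \<comment> \<open>A cycle through \<open>e\<close> would leave old edges with boundary
    \<open>e\<close>. Each old edge lies inside one block and meets \<open>A\<close> evenly, whereas
    \<open>e\<close> meets \<open>A\<close> in \<open>a\<close> alone.\<close>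
  have acyc: "acyclic_edges (insert e ?N)"
    unfolding acyclic_edges_def
  proof (intro allI impI)
    fix S assume S: "S \<subseteq> insert e ?N" "finite S" "bdry S = {}"
    have "e \<notin> S"
    proof
      assume eS: "e \<in> S"
      let ?S = "S - {e}"
      have "bdry (insert e ?S) = sym_diff e (bdry ?S)"
        using S(2) by (intro bdry_insert) simp_all
      then have "bdry ?S = e"
        using S(3) eS by (simp add: insert_absorb) blast
      moreover have "finite e' \<and> even (card (e' \<inter> A))" if "e' \<in> ?S" for e'
      proof -
        have e': "Edge e' \<in> set ys"
          using that S(1) merging_edges[of e'] by blast
        then have "e' \<in> E"
          using s by (auto simp flip: Edge_in_order)
        obtain D where D: "D \<in> C" "e' \<subseteq> D"
          using edges_in_blocks[OF e'] by blast
        then have "e' \<inter> A = e' \<or> e' \<inter> A = {}"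
          using blocks_disjoint[of D A] AB(1) by blast
        then have "even (card (e' \<inter> A))"
          using edge_card[OF \<open>e' \<in> E\<close>] by (elim disjE) simp_all
        then show ?thesis
          using edge_subset[OF \<open>e' \<in> E\<close>] finite_V finite_subset by blast
      qed
      ultimately have "even (card (e \<inter> A))"
        using even_card_bdry_Int[of ?S A] S(2) by simp
      moreover have "e \<inter> A = {a}"
        using ab AB disj by auto
      ultimately show False
        by simp
    qed
    then have "S \<subseteq> ?N"
      using S(1) by blast
    then show "S = {}"
      using merging_acyclic S(2,3) by (simp add: acyclic_edges_def)
  qed
  have earliest_U: "earliest_node s (A \<union> B) \<in> {p, q} - {d}"
  proof -
    let ?m = "earliest_node s (A \<union> B)"
    have m: "?m \<in> A \<union> B"
      using AB by (intro earliest_node_in) auto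
    have "pos (Node ?m) \<le> pos (Node w)"
      using w(1) p q by (intro earliest_node_le) auto
    then have "?m \<noteq> d"
      using w(2) by auto
    have mV: "?m \<in> V"
    proof -
      have "Node ?m \<in> set ys"
        using m AB Union_blocks by blast
      then show ?thesis using s by (auto simp flip: Node_in_order)
    qed
    have "pos (Node ?m) \<le> pos (Node p)" "pos (Node ?m) \<le> pos (Node q)"
      using p q by (auto intro: earliest_node_le)
    then have "pos (Node ?m) = pos (Node p) \<or> pos (Node ?m) = pos (Node q)"
      using m earliest_node_le[of ?m A] earliest_node_le[of ?m B] by (auto simp: p_def q_def)
    then have "?m = p \<or> ?m = q"
      using position_inj[of "Node ?m" "Node p"] position_inj[of "Node ?m" "Node q"] V mV by auto
    then show ?thesis
      using \<open>?m \<noteq> d\<close> by simp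
  qed
  have alive: "p \<notin> fst ` set L" "q \<notin> fst ` set L"
    using earliest_alive AB by (simp_all add: p_def q_def)
  have "union_find_state V E s (ys @ [Edge e]) ?C ?L"
  proof unfold_locales
    show "\<Union>?C = {v. Node v \<in> set (ys @ [Edge e])}"
      using Union_blocks AB by auto
    have other: "D \<inter> (A \<union> B) = {}" if "D \<in> C - {A, B}" for D
      using that blocks_disjoint[of D A] blocks_disjoint[of D B] AB(1,2) by (simp add: Int_Un_distrib)
    show "D \<inter> F = {}" if "D \<in> ?C" "F \<in> ?C" "D \<noteq> F" for D F
    proof (cases "D = A \<union> B")
      case True
      then show ?thesis
        using that other[of F] by (simp add: Int_commute)
    next
      case False
      then show ?thesis
        using that other[of D] blocks_disjoint[of D F] by (cases "F = A \<union> B") simp_all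
    qed
    show "{} \<notin> ?C"
      using blocks_nonempty AB by auto
    show "linked (snd ` set ?L) u v" if "D \<in> ?C" "u \<in> D" "v \<in> D" for D u v
    proof (cases "D = A \<union> B")
      case True
      then show ?thesis
        unfolding N' using linked_a[of u] linked_sym[OF linked_a[of v]] that(2,3)
        by (simp add: linked_trans[of _ u a v])
    next
      case False
      then show ?thesis
        unfolding N' using mono blocks_linked[of D u v] that by simp
    qed
    show "\<exists>D\<in>?C. e' \<subseteq> D" if e': "Edge e' \<in> set (ys @ [Edge e])" for e'
    proof (cases "e' = e")
      case True
      then have "e' \<subseteq> A \<union> B"
        using ab AB by simp
      then show ?thesis by blast
    next
      case False
      then obtain D where "D \<in> C" "e' \<subseteq> D"
        using e' edges_in_blocks[of e'] by auto
      then show ?thesis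
        by (cases "D \<in> {A, B}") auto
    qed
    show "Edge e' \<in> set (ys @ [Edge e])" if "e' \<in> snd ` set ?L" for e'
      using that merging_edges[of e'] unfolding N' by auto
    show "acyclic_edges (snd ` set ?L)"
      unfolding N' by (rule acyc)
    show "distinct (map snd ?L)"
      using distinct_snd eN by simp
    show "distinct (map fst ?L)"
      using distinct_fst alive d(1) by auto
    show "fst ` set ?L \<subseteq> \<Union>?C"
      unfolding D' using dead_nodes dAB by auto
    show "earliest_node s D \<notin> fst ` set ?L" if D: "D \<in> ?C" for D
    proof (cases "D = A \<union> B")
      case True
      then show ?thesis
        unfolding D' using earliest_U alive by auto
    next
      case False
      then have DC: "D \<in> C" "D \<noteq> A" "D \<noteq> B"
        using D by auto
      then have "D \<inter> A = {}" "D \<inter> B = {}"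
        using blocks_disjoint AB by simp_all
      moreover have "earliest_node s D \<in> D"
        using DC(1) blocks_nonempty by (intro earliest_node_in) auto
      ultimately have "earliest_node s D \<noteq> d"
        using dAB by auto
      then show ?thesis
        unfolding D' using earliest_alive[OF DC(1)] by simp
    qed
    show "\<exists>w S. w \<in> V \<and> pos (Node w) < pos (Node v) \<and> S \<subseteq> snd ` set ?L \<inter> before e' \<and> finite S \<and>
        bdry (insert e' S) = {v, w}" if ve: "(v, e') \<in> set ?L" for v e'
    proof (cases "(v, e') \<in> set L")
      case True
      from merging_chain[OF this] show ?thesis
        unfolding N' by (elim exE conjE, intro exI conjI) (assumption | rule subset_insert_Int)+
    next
      case False
      then have v: "v = d" "e' = e"
        using ve by auto
      obtain S where S: "S \<subseteq> ?N" "finite S" "bdry (insert e S) = {d, w}"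
        using chain by blast
      have "S \<subseteq> snd ` set ?L \<inter> before e"
        unfolding N' using S(1) bef[OF merging_edges] by (simp add: subset_iff)
      then show ?thesis
        unfolding v using S(2,3) w(2,3) by (intro exI[of _ w] exI[of _ S] conjI)
    qed
    show "\<exists>S\<subseteq>snd ` set ?L \<inter> before e'. finite S \<and> bdry S = e'"
      if "Edge e' \<in> set (ys @ [Edge e])" "e' \<notin> snd ` set ?L" for e'
    proof -
      have "Edge e' \<in> set ys" "e' \<notin> ?N"
        using that unfolding N' by auto
      from nonmerging_chain[OF this] show ?thesis
        unfolding N' by (elim exE conjE, intro exI conjI) (assumption | rule subset_insert_Int)+
    qed
  qed
  then show ?thesis
    by (simp add: blocks d_def)
qed

text \<open>Both endpoints lie in one block, so earlier merging edges already form a chain between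
  them. In the ascending pass this chain cancels the column of \<open>e\<close>; in the descending
  pass it starts the loop of \<open>e\<close>.\<close>

lemma union_find_state_skip:
  assumes "union_find_state V E s ys C L" and s: "s = ys @ Edge e # xs"
    and "card (blocks_at C e) \<noteq> 2"
  shows "union_find_state V E s (ys @ [Edge e]) C L"
proof -
  interpret union_find_state V E s ys C L by fact
  obtain a b A B where ab: "e = {a, b}" "a \<noteq> b" and AB: "A \<in> C" "B \<in> C" "a \<in> A" "b \<in> B"
    and blocks: "blocks_at C e = {A, B}" and e: "e \<in> E" "Edge e \<notin> set ys"
    and bef: "\<And>e'. Edge e' \<in> set ys \<Longrightarrow> e' \<in> before e"
    by (rule edge_blocks[OF assms(1) s]) (rule that)
  have "A = B"
    using assms(3) blocks by (cases "A = B") auto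
  then have "linked (snd ` set L) a b"
    using AB blocks_linked by simp
  then obtain S where S: "S \<subseteq> snd ` set L" "finite S" "bdry S = sym_diff {a} {b}"
    by (rule linkedE)
  have "bdry S = e"
    using S(3) ab by auto
  moreover have "S \<subseteq> snd ` set L \<inter> before e"
    using S(1) bef merging_edges by blast
  ultimately have chain: "\<exists>S\<subseteq>snd ` set L \<inter> before e. finite S \<and> bdry S = e"
    using S(2) by blast
  show ?thesis
  proof unfold_locales
    show "\<Union>C = {v. Node v \<in> set (ys @ [Edge e])}"
      using Union_blocks by auto
    show "\<exists>B\<in>C. e' \<subseteq> B" if "Edge e' \<in> set (ys @ [Edge e])" for e'
    proof (cases "e' = e")
      case True
      then show ?thesis
        using AB \<open>A = B\<close> ab by auto
    next
      case False
      then show ?thesis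
        using that edges_in_blocks[of e'] by simp
    qed
    show "\<exists>S\<subseteq>snd ` set L \<inter> before e'. finite S \<and> bdry S = e'"
      if "Edge e' \<in> set (ys @ [Edge e])" "e' \<notin> snd ` set L" for e'
    proof (cases "e' = e")
      case True
      then show ?thesis using chain by simp
    next
      case False
      then show ?thesis
        using that nonmerging_chain[of e'] by simp
    qed
    show "Edge e' \<in> set (ys @ [Edge e])" if "e' \<in> snd ` set L" for e'
      using that merging_edges[of e'] by simp
  qed (rule blocks_disjoint blocks_nonempty blocks_linked merging_acyclic distinct_snd distinct_fst
      dead_nodes earliest_alive merging_chain; assumption)+
qed

lemma union_find_pass_state:
  assumes "union_find_state V E s ys C L" and "s = ys @ xs"
  shows "\<exists>C'. union_find_state V E s s C' (L @ union_find_pass s C xs)"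
  using assms
proof (induction xs arbitrary: ys C L)
  case Nil
  then show ?case by auto
next
  case (Cons x xs)
  have s: "s = (ys @ [x]) @ xs"
    using Cons.prems(2) by simp
  show ?case
  proof (cases x)
    case (Node v)
    have "union_find_state V E s (ys @ [x]) (insert {v} C) L"
      using Cons.prems unfolding Node by (rule union_find_state_Node)
    from Cons.IH[OF this s] show ?thesis
      by (simp add: Node)
  next
    case (Edge e)
    show ?thesis
    proof (cases "card (blocks_at C e) = 2")
      case True
      have "union_find_state V E s (ys @ [x])
        (insert (\<Union>(blocks_at C e)) (C - blocks_at C e)) (L @ [(dying_node s C e, e)])"
        using Cons.prems True unfolding Edge by (rule union_find_state_join)
      from Cons.IH[OF this s] show ?thesis
        using True by (simp add: Edge)
    next
      case False
      have "union_find_state V E s (ys @ [x]) C L"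
        using Cons.prems False unfolding Edge by (rule union_find_state_skip)
      from Cons.IH[OF this s] show ?thesis
        using False by (simp add: Edge)
    qed
  qed
qed

lemma merges_state: "\<exists>C. union_find_state V E s s C (merges s)"
  using union_find_pass_state[OF union_find_state_init, of s] by (simp add: merges_def)

end

section \<open>Loops\<close>

text \<open>Keeps the edges themselves: different edges may have equal values, so distinctness is
  not visible in the points of \<open>loop_pass\<close>.\<close>

fun loop_pairs ::
  "'a simplex list \<Rightarrow> 'a \<Rightarrow> 'a set set \<Rightarrow> 'a set list \<Rightarrow> ('a set \<times> 'a set) list" where
  "loop_pairs \<kappa> r T [] = []"
| "loop_pairs \<kappa> r T (e # es) =
     (let e' = latest_edge \<kappa> (loop T r e)
      in (e', e) # loop_pairs \<kappa> r (insert e T - {e'}) es)"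

lemma loop_pass_eq:
  "loop_pass f \<kappa> r T es =
     mset (map (\<lambda>(e', e). (asc_value f (Edge e'), desc_value f (Edge e))) (loop_pairs \<kappa> r T es))"
  by (induction es arbitrary: T) (simp_all add: Let_def)

lemma map_snd_loop_pairs [simp]: "map snd (loop_pairs \<kappa> r T es) = es"
  by (induction es arbitrary: T) (simp_all add: Let_def)

lemma latest_edge_properties:
  assumes "finite L" "e \<in> L"
  shows "latest_edge \<kappa> L \<in> L" and "x \<in> L \<Longrightarrow> position \<kappa> (Edge x) \<le> position \<kappa> (Edge (latest_edge \<kappa> L))"
proof -
  have bound: "\<forall>y. y \<in> L \<longrightarrow> position \<kappa> (Edge y) < Suc (Max ((\<lambda>x. position \<kappa> (Edge x)) ` L))"
    using assms(1) by (simp add: le_imp_less_Suc)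
  from arg_max_nat_lemma[of "\<lambda>x. x \<in> L", OF assms(2) bound]
  show "latest_edge \<kappa> L \<in> L" and "x \<in> L \<Longrightarrow> position \<kappa> (Edge x) \<le> position \<kappa> (Edge (latest_edge \<kappa> L))"
    by (simp_all add: latest_edge_def)
qed

text \<open>
  A chain through the edge removed from a loop is rerouted along the rest of the loop.
\<close>

lemma reroute:
  assumes "finite Q" "Q \<subseteq> T" "finite S" "S \<subseteq> T" "e \<notin> T" "bdry S = e" "e' \<in> insert e S"
  obtains R where "R \<subseteq> insert e T - {e'}" "R \<subseteq> Q \<union> insert e S" "finite R" "bdry R = bdry Q"
proof (cases "e' \<in> Q")
  case False
  show thesis
    by (rule that[of Q]) (use assms(1,2) False in auto)
next
  case True
  have loop: "bdry (insert e S) = {}"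
    using assms(3-6) by (subst bdry_insert) auto
  have fin: "finite (insert e S)"
    using assms(3) by simp
  show thesis
  proof (rule that[of "sym_diff Q (insert e S)"])
    show "bdry (sym_diff Q (insert e S)) = bdry Q"
      using bdry_sym_diff[OF assms(1) fin] loop by simp
    show "sym_diff Q (insert e S) \<subseteq> insert e T - {e'}"
      using True assms(2,4,7) by auto
  qed (use assms(1) fin in auto)
qed

text \<open>A cycle through \<open>e\<close> becomes a cycle in \<open>T\<close> when the loop is
  added, hence empty. So it was the whole loop, which contains the removed
  \<open>e'\<close>.\<close>

lemma acyclic_exchange:
  assumes "acyclic_edges T" "finite S" "S \<subseteq> T" "e \<notin> T" "bdry S = e" "e' \<in> insert e S"
  shows "acyclic_edges (insert e T - {e'})"
  unfolding acyclic_edges_def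
proof (intro allI impI)
  fix Q assume Q: "Q \<subseteq> insert e T - {e'}" "finite Q" "bdry Q = {}"
  show "Q = {}"
  proof (cases "e \<in> Q")
    case False
    then have "Q \<subseteq> T"
      using Q(1) by auto
    then show ?thesis
      using assms(1) Q by (simp add: acyclic_edges_def)
  next
    case True
    have loop: "bdry (insert e S) = {}"
      using assms(2-5) by (subst bdry_insert) auto
    let ?R = "sym_diff Q (insert e S)"
    have "bdry ?R = {}"
      using bdry_sym_diff[of Q "insert e S"] assms(2) Q(2,3) loop by simp
    moreover have "?R \<subseteq> T"
      using Q(1) True assms(3) by auto
    moreover have "finite ?R"
      using Q(2) assms(2) by simp
    ultimately have "?R = {}"
      using assms(1) unfolding acyclic_edges_def by meson
    then have "Q = insert e S"
      by blast
    then show ?thesis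
      using Q(1) assms(6) by blast
  qed
qed

section \<open>The invariant of the loop pass\<close>

locale two_orders = asc: ordered_graph V E \<kappa> + desc: ordered_graph V E \<Lambda>
  for V :: "'a set" and E :: "'a set set" and \<kappa> \<Lambda> :: "'a simplex list" +
  fixes r :: 'a
  assumes connected: "connected_graph V E" and root: "r \<in> V"
begin

text \<open>\<open>T\<close> is kept as a spanning tree in chain form. Disjointness from
  \<open>es\<close> matters because new tree edges come only from \<open>es\<close>; thus a removed
  edge cannot return.\<close>

definition loop_state :: "'a set set \<Rightarrow> 'a set list \<Rightarrow> bool" where
  "loop_state T es \<longleftrightarrow> T \<subseteq> E \<and> acyclic_edges T \<and> (\<forall>u\<in>V. linked T u r) \<and>
     set es \<subseteq> E \<and> set es \<inter> T = {} \<and> sorted_wrt (\<lambda>e e'. e \<in> desc.before e') es \<and>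
     (\<forall>e\<in>set es. \<exists>S \<subseteq> T \<inter> desc.before e. finite S \<and> bdry S = e)"

text \<open>What the column of \<open>e\<close> needs to know about its loop, with the tree and the
  root forgotten.\<close>

definition loop_witness :: "'a set \<Rightarrow> 'a set \<Rightarrow> bool" where
  "loop_witness e' e \<longleftrightarrow> (\<exists>S \<subseteq> E \<inter> desc.before e. finite S \<and> bdry S = e \<and> e' \<in> insert e S \<and>
     (\<forall>x\<in>insert e S. position \<kappa> (Edge x) \<le> position \<kappa> (Edge e')))"

lemma loop_state_step:
  assumes "loop_state T (e # es)"
  defines "e' \<equiv> latest_edge \<kappa> (loop T r e)"
  shows "loop_witness e' e" and "e' \<in> insert e T" and "loop_state (insert e T - {e'}) es"
proof -
  have T: "T \<subseteq> E" "acyclic_edges T" "\<And>u. u \<in> V \<Longrightarrow> linked T u r"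
    and e: "e \<in> E" "e \<notin> T" and es: "set es \<subseteq> E" "set es \<inter> T = {}"
    and sorted: "\<And>x. x \<in> set es \<Longrightarrow> e \<in> desc.before x" "sorted_wrt (\<lambda>e e'. e \<in> desc.before e') es"
    using assms(1) by (simp_all add: loop_state_def)
  have chains: "\<exists>S \<subseteq> T \<inter> desc.before x. finite S \<and> bdry S = x" if "x \<in> set (e # es)" for x
    using assms(1) that unfolding loop_state_def by (elim conjE) (rule bspec)
  obtain S where S: "S \<subseteq> T \<inter> desc.before e" "finite S" "bdry S = e"
    using chains[of e] by auto
  have ST: "S \<subseteq> T" and S_before: "\<And>x. x \<in> S \<Longrightarrow> x \<in> desc.before e"
    using S(1) by auto
  have edges: "edge_set T"
    unfolding edge_set_def using T(1) desc.edge_card by (simp add: subset_iff)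
  have linked_e: "\<And>u. u \<in> e \<Longrightarrow> linked T u r"
    using T(3) subsetD[OF desc.edge_subset[OF e(1)]] by simp
  \<comment> \<open>\<open>S\<close> is the chain promised by the invariant, so the loop inherits
    its position before \<open>e\<close>.\<close>
  have L: "loop T r e = insert e S"
    using edges T(2) linked_e desc.edge_card[OF e(1)] ST S(2,3) by (rule loop_eq)
  have e': "e' \<in> insert e S"
    and latest: "\<And>x. x \<in> insert e S \<Longrightarrow> position \<kappa> (Edge x) \<le> position \<kappa> (Edge e')"
    unfolding e'_def L by (rule latest_edge_properties[of _ e]; simp add: S(2))+
  show "loop_witness e' e"
    unfolding loop_witness_def
    by (intro exI[of _ S] conjI ballI e' latest) (use S T(1) in auto)
  show e'T: "e' \<in> insert e T"
    using e' ST by blast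
  let ?T = "insert e T - {e'}"
  have reroute_T: "\<exists>R\<subseteq>?T. R \<subseteq> Q \<union> insert e S \<and> finite R \<and> bdry R = bdry Q" if "finite Q" "Q \<subseteq> T" for Q
    by (rule reroute[OF that S(2) ST e(2) S(3) e']) blast
  have sub: "?T \<subseteq> E"
    using T(1) e(1) by auto
  have disj: "set es \<inter> ?T = {}"
    using es(2) sorted(1) by (auto simp: desc.before_def)
  have linked: "linked ?T u r" if u: "u \<in> V" for u
  proof -
    obtain Q where Q: "Q \<subseteq> T" "finite Q" "bdry Q = sym_diff {u} {r}"
      using T(3)[OF u] by (rule linkedE)
    then obtain R where R: "R \<subseteq> ?T" "finite R" "bdry R = bdry Q"
      using reroute_T[of Q] by auto
    show ?thesis
      using R(1,2) R(3)[unfolded Q(3)] by (rule linkedI)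
  qed
  have chains': "\<exists>S\<subseteq>?T \<inter> desc.before x. finite S \<and> bdry S = x" if x: "x \<in> set es" for x
  proof -
    obtain Q where Q: "Q \<subseteq> T \<inter> desc.before x" "finite Q" "bdry Q = x"
      using chains[of x] x by auto
    then have "Q \<subseteq> T"
      by simp
    from reroute_T[OF Q(2) this] obtain R
      where R: "R \<subseteq> ?T" "R \<subseteq> Q \<union> insert e S" "finite R" "bdry R = bdry Q"
      by (elim exE conjE)
    \<comment> \<open>A rerouted chain uses at most edges of \<open>Q\<close> and of the loop of
      \<open>e\<close>; the latter do not come after \<open>e\<close>, and \<open>e\<close> precedes
      \<open>x\<close>.\<close>
    have "y \<in> desc.before x" if "y \<in> Q \<union> insert e S" for y
      using that Q(1) sorted(1)[OF x] S_before[of y] by (auto simp: desc.before_def)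
    then have "R \<subseteq> ?T \<inter> desc.before x"
      using R(1,2) by (simp add: subset_iff)
    then show ?thesis
      using R(3,4) Q(3) by (intro exI[of _ R] conjI) simp_all
  qed
  have acyc: "acyclic_edges ?T"
    by (rule acyclic_exchange[OF T(2) S(2) ST e(2) S(3) e'])
  show "loop_state ?T es"
    unfolding loop_state_def
    by (intro conjI ballI sub acyc linked es(1) disj sorted(2) chains')
qed

text \<open>The inclusion in \<open>T \<union> set es\<close> carries the induction: later latest
  edges come from the tree without \<open>e'\<close> or from pending edges, and \<open>e'\<close> is
  in neither.\<close>

lemma loop_pairs_properties:
  assumes "loop_state T es"
  shows "distinct (map fst (loop_pairs \<kappa> r T es)) \<and> fst ` set (loop_pairs \<kappa> r T es) \<subseteq> T \<union> set es \<and>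
    (\<forall>(e', e) \<in> set (loop_pairs \<kappa> r T es). loop_witness e' e)"
  using assms
proof (induction es arbitrary: T)
  case Nil
  then show ?case by simp
next
  case (Cons e es)
  define e' where "e' = latest_edge \<kappa> (loop T r e)"
  note step = loop_state_step[OF Cons.prems, folded e'_def]
  have IH: "distinct (map fst (loop_pairs \<kappa> r (insert e T - {e'}) es))"
    "fst ` set (loop_pairs \<kappa> r (insert e T - {e'}) es) \<subseteq> (insert e T - {e'}) \<union> set es"
    "\<forall>(e', e) \<in> set (loop_pairs \<kappa> r (insert e T - {e'}) es). loop_witness e' e"
    using Cons.IH[OF step(3)] by blast+
  have pairs: "loop_pairs \<kappa> r T (e # es) = (e', e) # loop_pairs \<kappa> r (insert e T - {e'}) es"
    by (simp add: e'_def Let_def)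
  have "e' \<notin> set es"
    using step(2) Cons.prems by (auto simp: loop_state_def desc.before_def)
  then have "e' \<notin> fst ` set (loop_pairs \<kappa> r (insert e T - {e'}) es)"
    using subsetD[OF IH(2), of e'] by auto
  then have 1: "distinct (map fst (loop_pairs \<kappa> r T (e # es)))"
    using IH(1) unfolding pairs by simp
  have 2: "fst ` set (loop_pairs \<kappa> r T (e # es)) \<subseteq> T \<union> set (e # es)"
    using IH(2) step(2) unfolding pairs by auto
  have 3: "\<forall>(e', e) \<in> set (loop_pairs \<kappa> r T (e # es)). loop_witness e' e"
    using IH(3) step(1) unfolding pairs by simp
  show ?case
    using 1 2 3 by blast
qed

lemma set_positive_edges:
  "e \<in> set (positive_edges \<Lambda>) \<longleftrightarrow> e \<in> E \<and> e \<notin> negative_edges \<Lambda>"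
  by (auto simp: positive_edges_def split: simplex.splits simp flip: desc.Edge_in_order)

lemma sorted_edges_of_order:
  fixes p :: "'a simplex \<Rightarrow> nat"
  assumes "sorted_wrt (\<lambda>x y. p x < p y) xs"
  shows "sorted_wrt (\<lambda>e e'. p (Edge e) < p (Edge e')) [e. Edge e \<leftarrow> xs, P e]"
  using assms
proof (induction xs)
  case (Cons x xs)
  then show ?case
    by (cases x) (auto simp: sorted_wrt_append split: simplex.splits)
qed simp

lemma sorted_positive_edges: "sorted_wrt (\<lambda>e e'. e \<in> desc.before e') (positive_edges \<Lambda>)"
proof -
  have "sorted_wrt (\<lambda>x y. desc.pos x < desc.pos y) \<Lambda>"
    by (simp add: sorted_wrt_iff_nth_less)
  then show ?thesis
    unfolding positive_edges_def desc.before_def mem_Collect_eq by (rule sorted_edges_of_order)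
qed

lemma loop_state_init: "loop_state (negative_edges \<Lambda>) (positive_edges \<Lambda>)"
proof -
  obtain C where "union_find_state V E \<Lambda> \<Lambda> C (merges \<Lambda>)"
    using desc.merges_state by blast
  then interpret union_find_state V E \<Lambda> \<Lambda> C "merges \<Lambda>" .
  have "negative_edges \<Lambda> \<subseteq> E"
    using merging_edges unfolding negative_edges_def desc.Edge_in_order by (rule subsetI)
  moreover have "linked (negative_edges \<Lambda>) u r" if u: "u \<in> V" for u
  \<comment> \<open>Each edge of \<open>E\<close> lies inside a final block, whose nodes are linked
    by merging edges; so connectedness passes from \<open>E\<close> to them.\<close>
  proof (rule linked_lift[of E])
    obtain p where "is_path E u p r"
      using connected u root unfolding connected_graph_def by blast
    then show "linked E u r"
      by (rule is_path_linked)
    show "\<exists>a b. e = {a, b} \<and> a \<noteq> b \<and> linked (negative_edges \<Lambda>) a b" if e: "e \<in> E" for e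
    proof -
      obtain a b where ab: "e = {a, b}" "a \<noteq> b"
        using desc.edge_card[OF e] by (meson card_2_iff)
      have "Edge e \<in> set \<Lambda>"
        using e by simp
      then obtain B where B: "B \<in> C" "e \<subseteq> B"
        using edges_in_blocks[of e] by auto
      have "linked (negative_edges \<Lambda>) a b"
        unfolding negative_edges_def using B ab(1) by (intro blocks_linked[OF B(1)]) simp_all
      then show ?thesis
        using ab by (intro exI[of _ a] exI[of _ b] conjI)
    qed
  qed
  moreover have "\<exists>S \<subseteq> negative_edges \<Lambda> \<inter> desc.before e. finite S \<and> bdry S = e"
    if "e \<in> set (positive_edges \<Lambda>)" for e
    using that nonmerging_chain[of e] unfolding set_positive_edges negative_edges_def by simp
  ultimately show ?thesis
    using merging_acyclic sorted_positive_edges unfolding loop_state_def negative_edges_def[symmetric]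
    by (auto simp: set_positive_edges)
qed

end

section \<open>Columns of the extended matrix\<close>

lemma image_sym_diff:
  assumes "inj_on f (A \<union> B)"
  shows "f ` sym_diff A B = sym_diff (f ` A) (f ` B)"
proof -
  have "f ` (A - B) = f ` A - f ` B"
    by (rule inj_on_image_set_diff[OF assms]) auto
  moreover have "f ` (B - A) = f ` B - f ` A"
    by (rule inj_on_image_set_diff[OF assms]) auto
  ultimately show ?thesis
    by (simp add: image_Un)
qed

lemma bdry_subset: "bdry S \<subseteq> \<Union>S"
proof
  fix v assume "v \<in> bdry S"
  then have "{e \<in> S. v \<in> e} \<noteq> {}"
    by (auto simp: bdry_def simp del: Collect_empty_eq)
  then show "v \<in> \<Union>S"
    by auto
qed

context ordered_graph
begin

lemma incident_rows:
  assumes "e \<in> E"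
  shows "{i. i < length s \<and> incident (s ! i) (Edge e)} = (\<lambda>v. pos (Node v)) ` e"
proof (intro equalityI subsetI)
  fix i assume "i \<in> {i. i < length s \<and> incident (s ! i) (Edge e)}"
  then show "i \<in> (\<lambda>v. pos (Node v)) ` e"
    using position_nth[of i] by (cases "s ! i") auto
next
  fix i assume "i \<in> (\<lambda>v. pos (Node v)) ` e"
  then obtain v where v: "v \<in> e" "i = pos (Node v)"
    by auto
  then have "Node v \<in> set s"
    using edge_subset[OF assms] by auto
  then show "i \<in> {i. i < length s \<and> incident (s ! i) (Edge e)}"
    using v position_less nth_position by simp
qed

lemma equal_rows:
  assumes "x \<in> set s"
  shows "{i. i < length s \<and> s ! i = x} = {pos x}"
  using position_less[OF assms] nth_position[OF assms] by auto

lemma inj_on_pos_Node: "inj_on (\<lambda>v. pos (Node v)) V"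
proof (rule inj_onI)
  fix x y assume "x \<in> V" "y \<in> V" "pos (Node x) = pos (Node y)"
  then show "x = y"
    using position_inj[of "Node x" "Node y"] by simp
qed

lemma inj_on_pos_Edge: "inj_on (\<lambda>e. pos (Edge e)) E"
proof (rule inj_onI)
  fix x y assume "x \<in> E" "y \<in> E" "pos (Edge x) = pos (Edge y)"
  then show "x = y"
    using position_inj[of "Edge x" "Edge y"] by simp
qed

lemma bdry_subset_V: "S \<subseteq> E \<Longrightarrow> bdry S \<subseteq> V"
  using bdry_subset[of S] edge_subset by blast

lemma sum_order:
  "(\<Sum>j<length s. F (s ! j) j) = (\<Sum>v\<in>V. F (Node v) (pos (Node v))) + (\<Sum>e\<in>E. F (Edge e) (pos (Edge e)))"
proof -
  have "(\<Sum>j<length s. F (s ! j) j) = (\<Sum>j<length s. F (s ! j) (pos (s ! j)))"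
    by (intro sum.cong) simp_all
  also have "\<dots> = (\<Sum>x\<in>set s. F x (pos x))"
    by (intro sum.reindex_bij_betw[of "nth s"] bij_betw_nth distinct_order) simp_all
  also have "\<dots> = (\<Sum>x\<in>Node ` V. F x (pos x)) + (\<Sum>x\<in>Edge ` E. F x (pos x))"
    unfolding set_order simplices_def by (intro sum.union_disjoint) (auto simp: finite_V finite_E)
  also have "\<dots> = (\<Sum>v\<in>V. F (Node v) (pos (Node v))) + (\<Sum>e\<in>E. F (Edge e) (pos (Edge e)))"
    by (simp add: sum.reindex inj_on_def)
  finally show ?thesis .
qed

text \<open>An edge cannot come first, since its endpoints precede it.\<close>

lemma first_is_Node:
  assumes "V \<noteq> {}"
  obtains v where "v \<in> V" "0 < length s" "s ! 0 = Node v" "pos (Node v) = 0"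
proof -
  have "set s \<noteq> {}"
    using assms by (simp add: set_order simplices_def)
  then have l: "0 < length s"
    by simp
  then have "s ! 0 \<in> set s" and p: "pos (s ! 0) = 0"
    by (simp_all del: length_greater_0_conv)
  show thesis
  proof (cases "s ! 0")
    case (Node v)
    then show ?thesis
      using that[of v] l p \<open>s ! 0 \<in> set s\<close> by simp
  next
    case (Edge e)
    then have e: "e \<in> E"
      using \<open>s ! 0 \<in> set s\<close> by simp
    then have "e \<noteq> {}"
      using edge_card[OF e] by auto
    then obtain v where "v \<in> e"
      by auto
    then show ?thesis
      using incident_position_less[OF e] p Edge by fastforce
  qed
qed

end

text \<open>Translates a sum over edge columns into the multiset of recorded pairs. Swapping makes
  the edge the lookup key, which is unambiguous because the second components are distinct.\<close>

lemma sum_map_of_swap: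
  assumes "finite E" "distinct (map snd L)" "snd ` set L \<subseteq> E"
  shows "(\<Sum>e\<in>E. case map_of (map prod.swap L) e of None \<Rightarrow> {#} | Some v \<Rightarrow> {#h v e#}) =
    mset (map (\<lambda>(v, e). h v e) L)"
  using assms(2,3)
proof (induction L)
  case Nil
  then show ?case by simp
next
  case (Cons p L)
  obtain v e where p: "p = (v, e)"
    by (cases p)
  have e: "e \<in> E" "e \<notin> snd ` set L"
    using Cons.prems by (auto simp: p)
  let ?F = "\<lambda>L e. case map_of (map prod.swap L) e of None \<Rightarrow> {#} | Some v \<Rightarrow> {#h v e#}"
  have "map_of (map prod.swap L) e = None"
    using e(2) by (simp add: map_of_eq_None_iff image_image)
  then have "(\<Sum>x\<in>E. ?F L x) = (\<Sum>x\<in>E - {e}. ?F L x)"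
    using sum.remove[OF assms(1) e(1), of "?F L"] by simp
  moreover have "(\<Sum>x\<in>E. ?F (p # L) x) = {#h v e#} + (\<Sum>x\<in>E - {e}. ?F (p # L) x)"
    using sum.remove[OF assms(1) e(1), of "?F (p # L)"] by (simp add: p)
  moreover have "(\<Sum>x\<in>E - {e}. ?F (p # L) x) = (\<Sum>x\<in>E - {e}. ?F L x)"
    by (intro sum.cong) (simp_all add: p)
  ultimately show ?case
    using Cons by (simp add: p)
qed

lemma map_of_swap_SomeD: "map_of (map prod.swap L) e = Some v \<Longrightarrow> (v, e) \<in> set L"
  by (drule map_of_SomeD) auto

lemma map_of_swap_NoneD: "map_of (map prod.swap L) e = None \<Longrightarrow> e \<notin> snd ` set L"
  by (auto simp: map_of_eq_None_iff image_image)

section \<open>The columns of the extended matrix and sums of them\<close>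

context two_orders
begin

abbreviation col :: "nat \<Rightarrow> nat set" where
  "col \<equiv> column_set (extended_matrix \<kappa> \<Lambda>)"

abbreviation m :: nat where
  "m \<equiv> length \<kappa>"

lemma length_desc: "length \<Lambda> = m"
  using asc.distinct_order desc.distinct_order asc.set_order desc.set_order
  by (metis distinct_card)

lemma column_set_asc:
  assumes "j < m"
  shows "col j = {i. i < m \<and> incident (\<kappa> ! i) (\<kappa> ! j)}"
  using assms
  by (auto simp: column_set_def extended_matrix_def boundary_matrix_def permutation_matrix_def
      length_desc split: if_splits)

lemma column_set_desc:
  assumes "j < m"
  shows "col (m + j) = {i. i < m \<and> \<kappa> ! i = \<Lambda> ! j} \<union> (+) m ` {i. i < m \<and> incident (\<Lambda> ! i) (\<Lambda> ! j)}"
    (is "_ = ?A \<union> _ ` ?B")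
proof (intro equalityI subsetI)
  fix i assume i: "i \<in> col (m + j)"
  show "i \<in> ?A \<union> (+) m ` ?B"
  proof (cases "i < m")
    case True
    then show ?thesis
      using i assms by (simp add: column_set_def extended_matrix_def boundary_matrix_def
          permutation_matrix_def length_desc split: if_splits)
  next
    case False
    have "i < m + m" "extended_matrix \<kappa> \<Lambda> $$ (i, m + j) = 1"
      using i by (simp_all add: column_set_def extended_matrix_def boundary_matrix_def
          permutation_matrix_def length_desc)
    then have "i - m \<in> ?B"
      using False assms by (simp add: column_set_def extended_matrix_def boundary_matrix_def
          permutation_matrix_def length_desc split: if_splits)
    then show ?thesis
      using False by (intro UnI2 image_eqI[of _ _ "i - m"]) simp_all
  qed
next
  fix i assume "i \<in> ?A \<union> (+) m ` ?B"
  then show "i \<in> col (m + j)"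
    using assms by (auto simp: column_set_def extended_matrix_def boundary_matrix_def
        permutation_matrix_def length_desc)
qed

abbreviation asc_node :: "'a \<Rightarrow> nat" where
  "asc_node v \<equiv> asc.pos (Node v)"

abbreviation asc_edge :: "'a set \<Rightarrow> nat" where
  "asc_edge e \<equiv> asc.pos (Edge e)"

abbreviation desc_node :: "'a \<Rightarrow> nat" where
  "desc_node v \<equiv> m + desc.pos (Node v)"

abbreviation desc_edge :: "'a set \<Rightarrow> nat" where
  "desc_edge e \<equiv> m + desc.pos (Edge e)"

lemma asc_less: "v \<in> V \<Longrightarrow> asc_node v < m" "e \<in> E \<Longrightarrow> asc_edge e < m"
  using asc.position_less by simp_all

lemma desc_less: "v \<in> V \<Longrightarrow> desc.pos (Node v) < m" "e \<in> E \<Longrightarrow> desc.pos (Edge e) < m"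
  using desc.position_less[unfolded length_desc] by simp_all

lemma col_asc_node: "v \<in> V \<Longrightarrow> col (asc_node v) = {}"
proof -
  assume v: "v \<in> V"
  have "\<not> incident x (Node v)" for x :: "'a simplex"
    by (cases x) simp_all
  then show ?thesis
    using column_set_asc[OF asc_less(1)[OF v]] asc.nth_position[of "Node v"] v by simp
qed

lemma col_asc_edge: "e \<in> E \<Longrightarrow> col (asc_edge e) = asc_node ` e"
  using column_set_asc[OF asc_less(2)] asc.nth_position[of "Edge e"] asc.incident_rows[of e] by simp

lemma col_desc_node: "v \<in> V \<Longrightarrow> col (desc_node v) = {asc_node v}"
proof -
  assume v: "v \<in> V"
  have "\<not> incident x (Node v)" for x :: "'a simplex"
    by (cases x) simp_all
  moreover have "\<Lambda> ! desc.pos (Node v) = Node v"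
    using v by (intro desc.nth_position) simp
  ultimately show ?thesis
    using column_set_desc[OF desc_less(1)[OF v]] asc.equal_rows[of "Node v"] v by simp
qed

lemma col_desc_edge: "e \<in> E \<Longrightarrow> col (desc_edge e) = insert (asc_edge e) (desc_node ` e)"
proof -
  assume e: "e \<in> E"
  have "\<Lambda> ! desc.pos (Edge e) = Edge e"
    using e by (intro desc.nth_position) simp
  then show ?thesis
    using column_set_desc[OF desc_less(2)[OF e]] asc.equal_rows[of "Edge e"]
      desc.incident_rows[OF e, unfolded length_desc] e by (simp add: image_image)
qed

lemma asc_chain_in_span:
  assumes "finite S" "S \<subseteq> E" "\<And>e. e \<in> S \<Longrightarrow> asc_edge e < j"
  shows "asc_node ` bdry S \<in> prefix_span col j"
  using assms
proof (induction S rule: finite_induct)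
  case empty
  then show ?case
    by (simp add: empty_in_prefix_span)
next
  case (insert e S)
  have e: "e \<in> E"
    using insert.prems by simp
  have inj: "inj_on asc_node (e \<union> bdry S)"
    using asc.edge_subset[OF e] asc.bdry_subset_V[of S] insert.prems
    by (intro inj_on_subset[OF asc.inj_on_pos_Node]) simp
  have "asc_node ` bdry (insert e S) = sym_diff (col (asc_edge e)) (asc_node ` bdry S)"
    unfolding bdry_insert[OF insert.hyps(1,2)] col_asc_edge[OF e] by (rule image_sym_diff[OF inj])
  moreover have "col (asc_edge e) \<in> prefix_span col j"
    using insert.prems(2)[of e] by (intro column_in_prefix_span) simp
  moreover have "asc_node ` bdry S \<in> prefix_span col j"
    using insert.IH insert.prems by simp
  ultimately show ?case
    by (simp only: prefix_span_sym_diff)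
qed

text \<open>The sum of the columns \<open>desc_edge e\<close> over \<open>e \<in> S\<close>: the
  first part comes from the block P, the second from the block D.\<close>

definition chain_column :: "'a set set \<Rightarrow> nat set" where
  "chain_column S = asc_edge ` S \<union> desc_node ` bdry S"

lemma chain_column_insert:
  assumes "finite S" "S \<subseteq> E" "e \<in> E" "e \<notin> S"
  shows "chain_column (insert e S) = sym_diff (col (desc_edge e)) (chain_column S)"
proof -
  have inj: "inj_on desc_node (e \<union> bdry S)"
  proof (rule inj_on_subset)
    show "inj_on desc_node V"
      using desc.inj_on_pos_Node by (simp add: inj_on_def)
    show "e \<union> bdry S \<subseteq> V"
      using desc.edge_subset[OF assms(3)] desc.bdry_subset_V[OF assms(2)] by simp
  qed
  have new: "asc_edge e \<notin> asc_edge ` S"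
    using inj_on_image_mem_iff[OF asc.inj_on_pos_Edge assms(3,2)] assms(4) by simp
  have less: "i < m" if "i \<in> insert (asc_edge e) (asc_edge ` S)" for i
    using that asc_less(2) assms(2,3) by auto
  \<comment> \<open>Ascending rows lie below \<open>m\<close> and descending rows do not, so the two
    parts cannot cancel each other.\<close>
  have disjoint: "i \<notin> desc_node ` A" if "i \<in> insert (asc_edge e) (asc_edge ` S)" for i A
    using less[OF that] by auto
  have "chain_column (insert e S) =
    insert (asc_edge e) (asc_edge ` S) \<union> sym_diff (desc_node ` e) (desc_node ` bdry S)"
    unfolding chain_column_def bdry_insert[OF assms(1,4)] image_sym_diff[OF inj] by simp
  also have "\<dots> = sym_diff (insert (asc_edge e) (desc_node ` e)) (asc_edge ` S \<union> desc_node ` bdry S)"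
    using new disjoint[of _ e] disjoint[of _ "bdry S"] by auto
  finally show ?thesis
    unfolding col_desc_edge[OF assms(3)] chain_column_def .
qed

lemma chain_column_in_span:
  assumes "finite S" "S \<subseteq> E" "\<And>e. e \<in> S \<Longrightarrow> desc_edge e < j"
  shows "chain_column S \<in> prefix_span col j"
  using assms
proof (induction S rule: finite_induct)
  case empty
  then show ?case
    by (simp add: empty_in_prefix_span chain_column_def)
next
  case (insert e S)
  have "chain_column (insert e S) = sym_diff (col (desc_edge e)) (chain_column S)"
    using insert.hyps insert.prems by (intro chain_column_insert) simp_all
  moreover have "col (desc_edge e) \<in> prefix_span col j"
    using insert.prems(2)[of e] by (intro column_in_prefix_span) simp
  moreover have "chain_column S \<in> prefix_span col j"
    using insert.IH insert.prems by simp
  ultimately show ?case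
    by (simp only: prefix_span_sym_diff)
qed

lemma chain_column_in_coset:
  assumes "finite S" "S \<subseteq> E \<inter> desc.before e" "e \<in> E"
  shows "chain_column (insert e S) \<in> prefix_coset col (desc_edge e)"
proof -
  have S: "S \<subseteq> E" "e \<notin> S"
    using assms(2) by (auto simp: desc.before_def)
  have "sym_diff (col (desc_edge e)) (chain_column (insert e S)) = chain_column S"
    unfolding chain_column_insert[OF assms(1) S(1) assms(3) S(2)] by (rule sym_diff_cancel)
  moreover have "chain_column S \<in> prefix_span col (desc_edge e)"
    using assms(1,2) by (intro chain_column_in_span) (auto simp: desc.before_def)
  ultimately show ?thesis
    by (simp only: prefix_coset_iff)
qed

end

section \<open>The lowest entries read off the faster algorithm\<close>

lemma lowest_pair: "(a::nat) < b \<Longrightarrow> lowest {b, a} = Some b"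
  by (intro lowest_eqI) auto

text \<open>The invariants at the end of the pass, with chains of merging edges relaxed to chains in
  \<open>E\<close>; spans of columns need no more.\<close>

lemma (in ordered_graph) merges_properties:
  shows distinct_fst_merges: "distinct (map fst (merges s))"
    and distinct_snd_merges: "distinct (map snd (merges s))"
    and merges_edges: "snd ` set (merges s) \<subseteq> E"
    and merges_nodes: "fst ` set (merges s) \<subseteq> V"
    and merges_chain: "(v, e) \<in> set (merges s) \<Longrightarrow>
      \<exists>w S. w \<in> V \<and> pos (Node w) < pos (Node v) \<and> S \<subseteq> E \<inter> before e \<and> finite S \<and>
        bdry (insert e S) = {v, w}"
    and not_merges_chain: "e \<in> E \<Longrightarrow> e \<notin> snd ` set (merges s) \<Longrightarrow>
      \<exists>S \<subseteq> E \<inter> before e. finite S \<and> bdry S = e"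
proof -
  obtain C where "union_find_state V E s s C (merges s)"
    using merges_state by blast
  then interpret union_find_state V E s s C "merges s" .
  show E: "snd ` set (merges s) \<subseteq> E"
    using merging_edges unfolding Edge_in_order by (rule subsetI)
  show "distinct (map fst (merges s))" "distinct (map snd (merges s))"
    by (fact distinct_fst distinct_snd)+
  show "fst ` set (merges s) \<subseteq> V"
    using dead_nodes unfolding Union_blocks by simp
  have sub: "S \<subseteq> E \<inter> F" if "S \<subseteq> snd ` set (merges s) \<inter> F" for S F
    using that E by blast
  show "\<exists>w S. w \<in> V \<and> pos (Node w) < pos (Node v) \<and> S \<subseteq> E \<inter> before e \<and> finite S \<and>
        bdry (insert e S) = {v, w}" if "(v, e) \<in> set (merges s)"
    using merging_chain[OF that] by (elim exE conjE, intro exI conjI) (assumption | rule sub)+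
  show "\<exists>S \<subseteq> E \<inter> before e. finite S \<and> bdry S = e" if e: "e \<in> E" "e \<notin> snd ` set (merges s)"
  proof -
    have "Edge e \<in> set s"
      using e(1) by simp
    from nonmerging_chain[OF this e(2)] show ?thesis
      by (elim exE conjE, intro exI conjI) (assumption | rule sub)+
  qed
qed

context two_orders
begin

definition loop_list :: "('a set \<times> 'a set) list" where
  "loop_list = loop_pairs \<kappa> r (negative_edges \<Lambda>) (positive_edges \<Lambda>)"

fun asc_low :: "'a simplex \<Rightarrow> nat option" where
  "asc_low (Node v) = None"
| "asc_low (Edge e) = map_option asc_node (map_of (map prod.swap (merges \<kappa>)) e)"

text \<open>Row 0 is that of the first ascending node; pairing it with the first descending node
  gives the point (min, max).\<close>

fun desc_low :: "'a simplex \<Rightarrow> nat option" where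
  "desc_low (Node v) = (if desc.pos (Node v) = 0 then Some 0 else None)"
| "desc_low (Edge e) =
     (case map_of (map prod.swap (merges \<Lambda>)) e of
        Some v \<Rightarrow> Some (desc_node v)
      | None \<Rightarrow> map_option asc_edge (map_of (map prod.swap loop_list) e))"

definition lows :: "nat \<Rightarrow> nat option" where
  "lows j = (if j < m then asc_low (\<kappa> ! j) else desc_low (\<Lambda> ! (j - m)))"

lemma snd_loop_list: "map snd loop_list = positive_edges \<Lambda>"
  by (simp add: loop_list_def)

lemma loop_list_properties:
  shows distinct_fst_loop_list: "distinct (map fst loop_list)"
    and distinct_snd_loop_list: "distinct (map snd loop_list)"
    and set_snd_loop_list: "snd ` set loop_list = E - negative_edges \<Lambda>"
    and fst_loop_list: "fst ` set loop_list \<subseteq> E"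
    and loop_list_witness: "(e', e) \<in> set loop_list \<Longrightarrow> loop_witness e' e"
proof -
  note state = loop_pairs_properties[OF loop_state_init, folded loop_list_def]
  show "distinct (map fst loop_list)"
    using state by blast
  have "distinct es" if "sorted_wrt (\<lambda>e e'. e \<in> desc.before e') es" for es
    using that by (induction es) (auto simp: desc.before_def)
  then have "distinct (positive_edges \<Lambda>)"
    using sorted_positive_edges by simp
  then show "distinct (map snd loop_list)"
    by (simp only: snd_loop_list)
  have "snd ` set loop_list = set (map snd loop_list)"
    by simp
  also have "\<dots> = E - negative_edges \<Lambda>"
    using set_positive_edges unfolding snd_loop_list by auto
  finally show "snd ` set loop_list = E - negative_edges \<Lambda>" .
  have "negative_edges \<Lambda> \<subseteq> E"
    using desc.merges_edges by (simp add: negative_edges_def)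
  moreover have "set (positive_edges \<Lambda>) \<subseteq> E"
    using set_positive_edges by auto
  ultimately show "fst ` set loop_list \<subseteq> E"
    using state by (meson Un_least order_trans)
  show "loop_witness e' e" if "(e', e) \<in> set loop_list"
    using state that by blast
qed

text \<open>Adding the columns of the chain \<open>S\<close> turns the column of \<open>e\<close>
  into the empty set if \<open>e\<close> does not merge, and into the rows of \<open>v\<close> and
  the earlier \<open>w\<close> if it does.\<close>

lemma lows_asc_edge_in_coset:
  assumes e: "e \<in> E"
  shows "asc_low (Edge e) \<in> lowest ` prefix_coset col (asc_edge e)"
proof (cases "map_of (map prod.swap (merges \<kappa>)) e")
  case None
  obtain S where S: "S \<subseteq> E \<inter> asc.before e" "finite S" "bdry S = e"
    using asc.not_merges_chain[OF e map_of_swap_NoneD[OF None]] by blast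
  have "asc_node ` bdry S \<in> prefix_span col (asc_edge e)"
    using S(1,2) by (intro asc_chain_in_span) (auto simp: asc.before_def)
  then have "{} \<in> prefix_coset col (asc_edge e)"
    using S(3) by (simp add: prefix_coset_iff col_asc_edge[OF e])
  then show ?thesis
    using None by (intro image_eqI[of _ _ "{}"]) (simp_all add: lowest_def)
next
  case (Some v)
  obtain w S where w: "w \<in> V" "asc_node w < asc_node v"
    and S: "S \<subseteq> E \<inter> asc.before e" "finite S" "bdry (insert e S) = {v, w}"
    using asc.merges_chain[OF map_of_swap_SomeD[OF Some]] by blast
  have SE: "S \<subseteq> E" "e \<notin> S"
    using S(1) by (auto simp: asc.before_def)
  have inj: "inj_on asc_node (e \<union> bdry S)"
    using asc.edge_subset[OF e] asc.bdry_subset_V[OF SE(1)]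
    by (intro inj_on_subset[OF asc.inj_on_pos_Node]) simp
  have "asc_node ` bdry (insert e S) = sym_diff (col (asc_edge e)) (asc_node ` bdry S)"
    unfolding bdry_insert[OF S(2) SE(2)] col_asc_edge[OF e] by (rule image_sym_diff[OF inj])
  then have "sym_diff (col (asc_edge e)) (asc_node ` {v, w}) = asc_node ` bdry S"
    unfolding S(3) by (simp only: sym_diff_cancel)
  moreover have "asc_node ` bdry S \<in> prefix_span col (asc_edge e)"
    using S(1,2) by (intro asc_chain_in_span) (auto simp: asc.before_def)
  ultimately have "asc_node ` {v, w} \<in> prefix_coset col (asc_edge e)"
    by (simp only: prefix_coset_iff)
  moreover have "lowest (asc_node ` {v, w}) = Some (asc_node v)"
    using lowest_pair[OF w(2)] by simp
  ultimately show ?thesis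
    using Some by (intro image_eqI[of _ _ "asc_node ` {v, w}"]) simp_all
qed

lemma V_nonempty: "V \<noteq> {}"
  using root by auto

lemma lows_desc_node_in_coset:
  assumes v: "v \<in> V"
  shows "desc_low (Node v) \<in> lowest ` prefix_coset col (desc_node v)"
proof -
  obtain a where a: "a \<in> V" "asc_node a = 0"
    by (rule asc.first_is_Node[OF V_nonempty])
  obtain b where b: "b \<in> V" "desc.pos (Node b) = 0"
    by (rule desc.first_is_Node[OF V_nonempty])
  \<comment> \<open>All ascending columns precede every descending one, so the boundary of a chain
    from \<open>u\<close> to \<open>a\<close> is available here.\<close>
  have span: "sym_diff {asc_node u} {0} \<in> prefix_span col (desc_node v)" if u: "u \<in> V" for u
  proof -
    obtain p where "is_path E u p a"
      using connected u a(1) unfolding connected_graph_def by blast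
    then have "linked E u a"
      by (rule is_path_linked)
    then obtain S where S: "S \<subseteq> E" "finite S" "bdry S = sym_diff {u} {a}"
      by (rule linkedE)
    have "asc_edge e < desc_node v" if "e \<in> S" for e
      using asc_less(2)[of e] that S(1) by auto
    then have "asc_node ` sym_diff {u} {a} \<in> prefix_span col (desc_node v)"
      using asc_chain_in_span[OF S(2,1)] unfolding S(3) by simp
    moreover have "asc_node ` sym_diff {u} {a} = sym_diff (asc_node ` {u}) (asc_node ` {a})"
      using u a(1) by (intro image_sym_diff inj_on_subset[OF asc.inj_on_pos_Node]) simp
    ultimately show ?thesis
      using a(2) by simp
  qed
  show ?thesis
  proof (cases "desc.pos (Node v) = 0")
    case True
    have "{0} \<in> prefix_coset col (desc_node v)"
      unfolding prefix_coset_iff col_desc_node[OF v] by (rule span[OF v])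
    then show ?thesis
      using True by (intro image_eqI[of _ _ "{0}"]) (simp_all add: lowest_def)
  next
    case False
    \<comment> \<open>The column of the first descending node \<open>b\<close> puts
      \<open>{0}\<close> into the span, and then the single entry of column \<open>v\<close> cancels
      as well.\<close>
    have "col (desc_node b) = {asc_node b}"
      by (rule col_desc_node[OF b(1)])
    moreover have "col (desc_node b) \<in> prefix_span col (desc_node v)"
      using False b(2) by (intro column_in_prefix_span) simp
    ultimately have "{asc_node b} \<in> prefix_span col (desc_node v)"
      by simp
    from prefix_span_sym_diff[OF this span[OF b(1)]]
    have "{0} \<in> prefix_span col (desc_node v)"
      by (simp only: sym_diff_cancel)
    from prefix_span_sym_diff[OF this span[OF v]]
    have "sym_diff {0} (sym_diff {asc_node v} {0}) \<in> prefix_span col (desc_node v)" .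
    moreover have "sym_diff {0} (sym_diff {asc_node v} {0}) = {asc_node v}"
      by auto
    ultimately have "{} \<in> prefix_coset col (desc_node v)"
      unfolding prefix_coset_iff col_desc_node[OF v] by simp
    then show ?thesis
      using False by (intro image_eqI[of _ _ "{}"]) (simp_all add: lowest_def)
  qed
qed

text \<open>For a merging edge, the boundary \<open>{v, w}\<close> lies in rows from
  \<open>m\<close> on and so beats all edge rows. For a positive edge the loop is a cycle: only
  ascending edge rows are left, and the latest edge is lowest.\<close>

lemma lows_desc_edge_in_coset:
  assumes e: "e \<in> E"
  shows "desc_low (Edge e) \<in> lowest ` prefix_coset col (desc_edge e)"
proof (cases "map_of (map prod.swap (merges \<Lambda>)) e")
  case (Some v)
  have ve: "(v, e) \<in> set (merges \<Lambda>)"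
    by (rule map_of_swap_SomeD[OF Some])
  obtain w S where w: "w \<in> V" "desc.pos (Node w) < desc.pos (Node v)"
    and S: "S \<subseteq> E \<inter> desc.before e" "finite S" "bdry (insert e S) = {v, w}"
    using desc.merges_chain[OF ve] by blast
  have "lowest (chain_column (insert e S)) = Some (desc_node v)"
  proof (rule lowest_eqI)
    show "finite (chain_column (insert e S))"
      unfolding chain_column_def S(3) using S(2) by simp
    show "desc_node v \<in> chain_column (insert e S)"
      unfolding chain_column_def S(3) by simp
    fix k assume "k \<in> chain_column (insert e S)"
    then consider x where "x \<in> insert e S" "k = asc_edge x" | "k \<in> desc_node ` {v, w}"
      unfolding chain_column_def S(3) by auto
    then show "k \<le> desc_node v"
    proof cases
      case 1
      then have "x \<in> E"
        using e S(1) by auto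
      then show ?thesis
        using asc_less(2)[of x] 1(2) by simp
    qed (use w(2) in auto)
  qed
  then show ?thesis
    using Some chain_column_in_coset[OF S(2,1) e]
    by (intro image_eqI[of _ _ "chain_column (insert e S)"]) simp_all
next
  case None
  have "e \<notin> negative_edges \<Lambda>"
    using map_of_swap_NoneD[OF None] by (simp add: negative_edges_def)
  then have "e \<in> snd ` set loop_list"
    using e by (simp add: set_snd_loop_list)
  then obtain e' where e': "map_of (map prod.swap loop_list) e = Some e'"
    using map_of_swap_NoneD[of loop_list e] by (cases "map_of (map prod.swap loop_list) e") simp_all
  obtain S where S: "S \<subseteq> E \<inter> desc.before e" "finite S" "bdry S = e" and e'S: "e' \<in> insert e S"
    and latest: "\<forall>x\<in>insert e S. asc_edge x \<le> asc_edge e'"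
    using loop_list_witness[OF map_of_swap_SomeD[OF e']] unfolding loop_witness_def by blast
  have "e \<notin> S"
    using S(1) by (auto simp: desc.before_def)
  then have "chain_column (insert e S) = asc_edge ` insert e S"
    unfolding chain_column_def bdry_insert[OF S(2) \<open>e \<notin> S\<close>] S(3) by simp
  moreover have "lowest (asc_edge ` insert e S) = Some (asc_edge e')"
  proof (rule lowest_eqI)
    show "finite (asc_edge ` insert e S)"
      using S(2) by simp
    show "asc_edge e' \<in> asc_edge ` insert e S"
      using e'S by (rule imageI)
    show "k \<le> asc_edge e'" if "k \<in> asc_edge ` insert e S" for k
    proof -
      from that obtain x where x: "k = asc_edge x" "x \<in> insert e S"
        by (rule imageE)
      show ?thesis
        unfolding x(1) by (rule bspec[OF latest x(2)])
    qed
  qed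
  ultimately show ?thesis
    using None e' chain_column_in_coset[OF S(2,1) e]
    by (intro image_eqI[of _ _ "chain_column (insert e S)"]) simp_all
qed

text \<open>
  The column is recovered from its lowest entry, which makes the lowest entries distinct.
\<close>

definition column_of_low :: "nat \<Rightarrow> nat" where
  "column_of_low l =
     (if m \<le> l then
        (case \<Lambda> ! (l - m) of Node v \<Rightarrow> desc_edge (the (map_of (merges \<Lambda>) v)) | Edge _ \<Rightarrow> 0)
      else if l = 0 then m
      else (case \<kappa> ! l of Node v \<Rightarrow> asc_edge (the (map_of (merges \<kappa>) v))
            | Edge e' \<Rightarrow> desc_edge (the (map_of loop_list e'))))"

text \<open>Four kinds of rows are claimed by four kinds of columns: descending nodes by descending
  merges, row 0 by the first descending node, other ascending nodes by ascending merges, ascending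
  edges by loops.\<close>

lemma column_of_lows:
  assumes "j < m + m" "lows j = Some l"
  shows "column_of_low l = j"
proof -
  obtain a where a: "\<kappa> ! 0 = Node a" "0 < m" "asc_node a = 0"
    by (rule asc.first_is_Node[OF V_nonempty])
  show ?thesis
  proof (cases "j < m")
    case True
    then obtain e v where e: "\<kappa> ! j = Edge e" and v: "map_of (map prod.swap (merges \<kappa>)) e = Some v"
      and l: "l = asc_node v"
      using assms(2) by (cases "\<kappa> ! j") (auto simp: lows_def)
    have ve: "(v, e) \<in> set (merges \<kappa>)"
      by (rule map_of_swap_SomeD[OF v])
    then have vV: "v \<in> V"
      using asc.merges_nodes by force
    \<comment> \<open>A dying node has an earlier node \<open>w\<close>, so row 0 is not claimed by
      any merge.\<close>
    have "l \<noteq> 0"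
      using asc.merges_chain[OF ve] l by force
    moreover have "\<kappa> ! l = Node v"
      using vV l asc.nth_position[of "Node v"] by simp
    moreover have "map_of (merges \<kappa>) v = Some e"
      using ve asc.distinct_fst_merges by simp
    moreover have "asc_edge e = j"
      using asc.position_nth[of j] True e by simp
    ultimately show ?thesis
      using asc_less(1)[OF vV] l by (simp add: column_of_low_def)
  next
    case False
    define i where "i = j - m"
    have i: "i < length \<Lambda>" "j = m + i" "desc_low (\<Lambda> ! i) = Some l"
      using False assms length_desc by (auto simp: i_def lows_def)
    have pos_i: "desc.pos (\<Lambda> ! i) = i"
      using i(1) by (rule desc.position_nth)
    show ?thesis
    proof (cases "\<Lambda> ! i")
      case (Node v)
      then show ?thesis
        using i pos_i a(2) by (auto simp: column_of_low_def split: if_splits)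
    next
      case (Edge e)
      show ?thesis
      proof (cases "map_of (map prod.swap (merges \<Lambda>)) e")
        case (Some v)
        have ve: "(v, e) \<in> set (merges \<Lambda>)"
          by (rule map_of_swap_SomeD[OF Some])
        then have "v \<in> V"
          using desc.merges_nodes by force
        then have "\<Lambda> ! desc.pos (Node v) = Node v"
          by (intro desc.nth_position) simp
        moreover have "map_of (merges \<Lambda>) v = Some e"
          using ve desc.distinct_fst_merges by simp
        moreover have "l = desc_node v"
          using i(3) Edge Some by simp
        ultimately show ?thesis
          using pos_i i(2) Edge by (simp add: column_of_low_def)
      next
        case None
        then obtain e' where e': "map_of (map prod.swap loop_list) e = Some e'" "l = asc_edge e'"
          using i(3) Edge by auto
        have ee: "(e', e) \<in> set loop_list"
          by (rule map_of_swap_SomeD[OF e'(1)])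
        then have "e' \<in> E"
          using fst_loop_list by force
        then have "\<kappa> ! l = Edge e'" "l < m"
          using asc.nth_position[of "Edge e'"] asc_less(2) e'(2) by simp_all
        moreover have "l \<noteq> 0"
          using a(1) calculation(1) by (cases "l = 0") simp_all
        moreover have "map_of loop_list e' = Some e"
          using ee distinct_fst_loop_list by simp
        ultimately show ?thesis
          using pos_i i(2) Edge by (simp add: column_of_low_def)
      qed
    qed
  qed
qed

lemma reduced_lows_faster: "reduced_lows col (m + m) lows"
  unfolding reduced_lows_def
proof (intro conjI allI impI)
  fix j assume j: "j < m + m"
  show "lows j \<in> lowest ` prefix_coset col j"
  proof (cases "j < m")
    case True
    have j_pos: "asc.pos (\<kappa> ! j) = j" and mem: "\<kappa> ! j \<in> set \<kappa>"
      using True by simp_all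
    show ?thesis
    proof (cases "\<kappa> ! j")
      case (Node v)
      have "col j = {}"
        using col_asc_node[of v] j_pos mem Node by simp
      then have "{} \<in> prefix_coset col j"
        using column_in_prefix_coset[of col j] by simp
      then show ?thesis
        using True Node by (intro image_eqI[of _ _ "{}"]) (simp_all add: lows_def lowest_def)
    next
      case (Edge e)
      then show ?thesis
        using lows_asc_edge_in_coset[of e] j_pos mem True by (simp add: lows_def)
    qed
  next
    case False
    then obtain i where i: "j = m + i" "i < length \<Lambda>"
      using j length_desc le_Suc_ex[of m j] by auto
    have j_pos: "desc.pos (\<Lambda> ! i) = i" and mem: "\<Lambda> ! i \<in> set \<Lambda>"
      using i(2) by simp_all
    show ?thesis
    proof (cases "\<Lambda> ! i")
      case (Node v)
      then show ?thesis
        using lows_desc_node_in_coset[of v] j_pos mem i(1) by (simp add: lows_def)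
    next
      case (Edge e)
      then show ?thesis
        using lows_desc_edge_in_coset[of e] j_pos mem i(1) by (simp add: lows_def)
    qed
  qed
next
  fix j i assume ij: "j < m + m" "i < j" "lows i \<noteq> None"
  then obtain l where l: "lows i = Some l"
    by blast
  show "lows i \<noteq> lows j"
  proof
    assume "lows i = lows j"
    then have l': "lows j = Some l"
      using l by simp
    have "i < m + m"
      using ij(1,2) by simp
    then show False
      using column_of_lows[OF _ l] column_of_lows[OF ij(1) l'] ij(2) by simp
  qed
qed

end

section \<open>Summing the points of all columns\<close>

context two_orders
begin

lemma index_value_asc: "v \<in> V \<Longrightarrow> index_value f \<kappa> \<Lambda> (asc_node v) = f v"
  "e \<in> E \<Longrightarrow> index_value f \<kappa> \<Lambda> (asc_edge e) = asc_value f (Edge e)"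
  using asc_less asc.nth_position[of "Node v"] asc.nth_position[of "Edge e"]
  by (simp_all add: index_value_def)

lemma index_value_desc: "v \<in> V \<Longrightarrow> index_value f \<kappa> \<Lambda> (desc_node v) = f v"
  "e \<in> E \<Longrightarrow> index_value f \<kappa> \<Lambda> (desc_edge e) = desc_value f (Edge e)"
  using desc.nth_position[of "Node v"] desc.nth_position[of "Edge e"]
  by (simp_all add: index_value_def)

lemma sum_asc_lows:
  "(\<Sum>j<m. low_point f \<kappa> \<Lambda> (lows j) j) = mset (map (\<lambda>(v, e). (f v, asc_value f (Edge e))) (merges \<kappa>))"
proof -
  have edge: "low_point f \<kappa> \<Lambda> (asc_low (Edge e)) (asc_edge e) =
    (case map_of (map prod.swap (merges \<kappa>)) e of None \<Rightarrow> {#} | Some v \<Rightarrow> {#(f v, asc_value f (Edge e))#})"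
    if "e \<in> E" for e
  proof (cases "map_of (map prod.swap (merges \<kappa>)) e")
    case None
    then show ?thesis
      by (simp add: low_point_def)
  next
    case (Some v)
    then have "v \<in> V"
      using map_of_swap_SomeD[OF Some] asc.merges_nodes by force
    then show ?thesis
      using Some that by (simp add: low_point_def index_value_asc)
  qed
  have "(\<Sum>j<m. low_point f \<kappa> \<Lambda> (lows j) j) = (\<Sum>j<m. low_point f \<kappa> \<Lambda> (asc_low (\<kappa> ! j)) j)"
    by (intro sum.cong) (simp_all add: lows_def)
  also have "\<dots> = (\<Sum>v\<in>V. low_point f \<kappa> \<Lambda> (asc_low (Node v)) (asc_node v)) +
    (\<Sum>e\<in>E. low_point f \<kappa> \<Lambda> (asc_low (Edge e)) (asc_edge e))"
    by (rule asc.sum_order)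
  also have "\<dots> = (\<Sum>e\<in>E. case map_of (map prod.swap (merges \<kappa>)) e of None \<Rightarrow> {#}
      | Some v \<Rightarrow> {#(f v, asc_value f (Edge e))#})"
  proof -
    have "(\<Sum>v\<in>V. low_point f \<kappa> \<Lambda> (asc_low (Node v)) (asc_node v)) = {#}"
      by (simp add: low_point_def)
    moreover have "(\<Sum>e\<in>E. low_point f \<kappa> \<Lambda> (asc_low (Edge e)) (asc_edge e)) =
      (\<Sum>e\<in>E. case map_of (map prod.swap (merges \<kappa>)) e of None \<Rightarrow> {#}
        | Some v \<Rightarrow> {#(f v, asc_value f (Edge e))#})"
      by (intro sum.cong refl edge)
    ultimately show ?thesis
      by (simp only: empty_neutral)
  qed
  also have "\<dots> = mset (map (\<lambda>(v, e). (f v, asc_value f (Edge e))) (merges \<kappa>))"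
    by (rule sum_map_of_swap[OF asc.finite_E asc.distinct_snd_merges asc.merges_edges])
  finally show ?thesis .
qed

text \<open>Only the first descending node contributes. Sortedness identifies it as the maximum of
  \<open>f\<close>, and row 0 as the minimum.\<close>

lemma sum_desc_nodes:
  assumes asc: "ascending_sequence V E f \<kappa>" and desc: "descending_sequence V E f \<Lambda>"
  shows "(\<Sum>v\<in>V. low_point f \<kappa> \<Lambda> (desc_low (Node v)) (desc_node v)) = {#(Min (f ` V), Max (f ` V))#}"
proof -
  obtain a where a: "a \<in> V" "0 < m" "\<kappa> ! 0 = Node a" "asc_node a = 0"
    by (rule asc.first_is_Node[OF V_nonempty])
  obtain b where b: "b \<in> V" "0 < length \<Lambda>" "\<Lambda> ! 0 = Node b" "desc.pos (Node b) = 0"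
    by (rule desc.first_is_Node[OF V_nonempty])
  have "f a \<le> f v" if v: "v \<in> V" for v
  proof (cases "asc_node v = 0")
    case True
    then show ?thesis
      using asc.position_inj[of "Node v" "Node a"] a v by simp
  next
    case False
    then have "asc_value f (\<kappa> ! 0) \<le> asc_value f (\<kappa> ! asc_node v)"
      using asc asc_less(1)[OF v] unfolding ascending_sequence_def
      by (auto simp: sorted_wrt_map sorted_wrt_iff_nth_less)
    then show ?thesis
      using a(3) v asc.nth_position[of "Node v"] by simp
  qed
  then have "Min (f ` V) = f a"
    using a(1) asc.finite_V by (intro Min_eqI) auto
  moreover have "f v \<le> f b" if v: "v \<in> V" for v
  proof (cases "desc.pos (Node v) = 0")
    case True
    then show ?thesis
      using desc.position_inj[of "Node v" "Node b"] b v by simp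
  next
    case False
    then have "desc_value f (\<Lambda> ! desc.pos (Node v)) \<le> desc_value f (\<Lambda> ! 0)"
      using desc desc_less(1)[OF v] length_desc unfolding descending_sequence_def
      by (auto simp: sorted_wrt_map sorted_wrt_iff_nth_less)
    then show ?thesis
      using b(3) v desc.nth_position[of "Node v"] by simp
  qed
  then have "Max (f ` V) = f b"
    using b(1) asc.finite_V by (intro Max_eqI) auto
  moreover have "low_point f \<kappa> \<Lambda> (desc_low (Node v)) (desc_node v) =
      (if v = b then {#(f a, f b)#} else {#})" if v: "v \<in> V" for v
  proof (cases "v = b")
    case True
    then show ?thesis
      using index_value_asc(1)[OF a(1), of f] index_value_desc(1)[OF b(1), of f] a(4) b(4)
      by (simp add: low_point_def)
  next
    case False
    then have "desc.pos (Node v) \<noteq> 0"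
      using desc.position_inj[of "Node v" "Node b"] b(1,4) v by auto
    then show ?thesis
      using False by (simp add: low_point_def)
  qed
  ultimately show ?thesis
    using b(1) asc.finite_V by (simp add: sum.delta cong: sum.cong)
qed

lemma sum_desc_edges:
  "(\<Sum>e\<in>E. low_point f \<kappa> \<Lambda> (desc_low (Edge e)) (desc_edge e)) =
    mset (map (\<lambda>(v, e). (f v, desc_value f (Edge e))) (merges \<Lambda>)) + one_dim_PD f \<kappa> \<Lambda> r"
proof -
  let ?n = "\<lambda>e. case map_of (map prod.swap (merges \<Lambda>)) e of None \<Rightarrow> {#}
      | Some v \<Rightarrow> {#(f v, desc_value f (Edge e))#}"
  let ?p = "\<lambda>e. case map_of (map prod.swap loop_list) e of None \<Rightarrow> {#}
      | Some e' \<Rightarrow> {#(asc_value f (Edge e'), desc_value f (Edge e))#}"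
  \<comment> \<open>Negative and positive edges are disjoint, so at most one of the two lookups is
    nonempty and the sum can be split.\<close>
  have edge: "low_point f \<kappa> \<Lambda> (desc_low (Edge e)) (desc_edge e) = ?n e + ?p e" if e: "e \<in> E" for e
  proof (cases "map_of (map prod.swap (merges \<Lambda>)) e")
    case (Some v)
    note ve = map_of_swap_SomeD[OF Some]
    have "v \<in> V"
      using ve desc.merges_nodes by force
    moreover have "e \<in> negative_edges \<Lambda>"
      unfolding negative_edges_def using ve by (intro image_eqI[of _ _ "(v, e)"]) simp_all
    then have "e \<notin> snd ` set loop_list"
      unfolding set_snd_loop_list by simp
    then have "map_of (map prod.swap loop_list) e = None"
      by (simp add: map_of_eq_None_iff image_image)
    ultimately show ?thesis
      using Some e by (simp add: low_point_def index_value_desc)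
  next
    case None
    show ?thesis
    proof (cases "map_of (map prod.swap loop_list) e")
      case e': (Some e')
      have "e' \<in> E"
        using map_of_swap_SomeD[OF e'] fst_loop_list by force
      then show ?thesis
        using None e' e by (simp add: low_point_def index_value_desc index_value_asc del: asc_value.simps)
    qed (use None in \<open>simp add: low_point_def\<close>)
  qed
  have "(\<Sum>e\<in>E. low_point f \<kappa> \<Lambda> (desc_low (Edge e)) (desc_edge e)) = (\<Sum>e\<in>E. ?n e + ?p e)"
    by (intro sum.cong refl edge)
  also have "\<dots> = (\<Sum>e\<in>E. ?n e) + (\<Sum>e\<in>E. ?p e)"
    by (rule sum.distrib)
  also have "(\<Sum>e\<in>E. ?n e) = mset (map (\<lambda>(v, e). (f v, desc_value f (Edge e))) (merges \<Lambda>))"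
    by (rule sum_map_of_swap[OF asc.finite_E desc.distinct_snd_merges desc.merges_edges])
  also have "(\<Sum>e\<in>E. ?p e) =
      mset (map (\<lambda>(e', e). (asc_value f (Edge e'), desc_value f (Edge e))) loop_list)"
    by (rule sum_map_of_swap[OF asc.finite_E distinct_snd_loop_list]) (simp add: set_snd_loop_list)
  also have "\<dots> = one_dim_PD f \<kappa> \<Lambda> r"
    by (simp only: one_dim_PD_def loop_pass_eq loop_list_def)
  finally show ?thesis .
qed

lemma sum_lows:
  assumes "ascending_sequence V E f \<kappa>" and "descending_sequence V E f \<Lambda>"
  shows "(\<Sum>j<m + length \<Lambda>. low_point f \<kappa> \<Lambda> (lows j) j) = zero_dim_PD V f \<kappa> \<Lambda> + one_dim_PD f \<kappa> \<Lambda> r"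
proof -
  have "(\<Sum>j<m + n. F j) = (\<Sum>j<m. F j) + (\<Sum>j<n. F (m + j))" for n and F :: "nat \<Rightarrow> (real \<times> real) multiset"
    by (induction n) (simp_all add: add.assoc)
  then have "(\<Sum>j<m + length \<Lambda>. low_point f \<kappa> \<Lambda> (lows j) j) =
    (\<Sum>j<m. low_point f \<kappa> \<Lambda> (lows j) j) + (\<Sum>j<length \<Lambda>. low_point f \<kappa> \<Lambda> (lows (m + j)) (m + j))"
    by blast
  also have "(\<Sum>j<length \<Lambda>. low_point f \<kappa> \<Lambda> (lows (m + j)) (m + j)) =
    (\<Sum>j<length \<Lambda>. low_point f \<kappa> \<Lambda> (desc_low (\<Lambda> ! j)) (m + j))"
    by (simp add: lows_def)
  also have "\<dots> = (\<Sum>v\<in>V. low_point f \<kappa> \<Lambda> (desc_low (Node v)) (desc_node v)) +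
    (\<Sum>e\<in>E. low_point f \<kappa> \<Lambda> (desc_low (Edge e)) (desc_edge e))"
    by (rule desc.sum_order[of "\<lambda>x j. low_point f \<kappa> \<Lambda> (desc_low x) (m + j)"])
  finally show ?thesis
    unfolding sum_asc_lows sum_desc_nodes[OF assms] sum_desc_edges zero_dim_PD_def
    by (simp only: ac_simps)
qed

end

text \<open>The equivalence form covers the existence of a complete run and its independence of the
  choices of \<open>k\<close>.\<close>

theorem theorem1:
  fixes V :: "'a set" and E :: "'a set set" and f :: "'a \<Rightarrow> real"
    and \<kappa> \<Lambda> :: "'a simplex list" and r :: 'a
    and PD :: "(real \<times> real) multiset"
  assumes "simple_graph V E" and "connected_graph V E"
    and "inj_on f V"
    and "ascending_sequence V E f \<kappa>"
    and "descending_sequence V E f \<Lambda>"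
    and "r \<in> V"
  shows "matrix_reduction_outputs f \<kappa> \<Lambda> PD \<longleftrightarrow>
    PD = zero_dim_PD V f \<kappa> \<Lambda> + one_dim_PD f \<kappa> \<Lambda> r"
proof -
  interpret two_orders V E \<kappa> \<Lambda> r
    using assms(1,2,4-6)
    by unfold_locales (simp_all add: ascending_sequence_def descending_sequence_def)
  have "reduced_lows col (length \<kappa> + length \<Lambda>) lows"
    using reduced_lows_faster by (simp only: length_desc)
  then show ?thesis
    by (simp only: matrix_reduction_outputs_iff sum_lows[OF assms(4,5)])
qed

end
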